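(* Let $a\in(0,1)$, $n\ge 2$, and $P(z) = (z-a)\prod_{j=1}^{n-1}(z-z_j)$ with $|z_j| \leq 1$ for all $j = 1, \ldots , n-1$. Define $\gamma(a) = 0.1a+0.9$, $c = a\gamma(a)$, $p' = \frac{a/4}{1-a/2}$, $q' = \frac{a/4}{1+a/2}$, $r = \frac{c(a-c)}{2(1-c^2)}$, $\alpha = \frac{\log ( a/16 )}{\log \left( \frac{c+r}{1+cr} \right)}$, $$K' = \min \left\{ (1+c-ac)^{p'} \left(\sqrt{1+c^2-ac}\right)^{1-p'},\ (1+c)^{q'} \left(\sqrt{1+c^2-ac}\right)^{1-q'} \right\},$$ $\mathcal{N}_0(a) = \frac{32 \log ( 40/a^2 )}{a^2}$, $\mathcal{N}_1(a) = \max \left \{ 9 \left( \frac{4+2a}{a} \right)^2 , \mathcal{N}_0(a) \right \}$, $\mathcal{N}_2(a,c) = \max \left \{ 9 \left( \frac{\log ( a/16 )}{\log \left( \frac{c}{1+a} \right) } \right)^2 , \mathcal{N}_0(a) \right \}$, and $$\mathcal{N}_3(a) = \max\left\{\mathcal{N}_0(a),\ \frac{\log \left( \frac{1+a}{a-c} \right) + \log \left( \frac{1-ac}{1-c} \right) - \alpha \log(r)}{\log (K')} + 1\right\}.$$ If $n > \max \{ \mathcal{N}_1(a), \mathcal{N}_2(a, c), \mathcal{N}_3(a) \}$, then $P'$ has a zero in the closed disk $\{z : |z-a|\leq 1\}$. *)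

theory Defs
  imports "HOL-Analysis.Analysis" "HOL-Computational_Algebra.Polynomial"
begin

definition gam :: "real \<Rightarrow> real" where "gam a = 0.1 * a + 0.9"
definition cc :: "real \<Rightarrow> real" where "cc a = a * gam a"
definition pp :: "real \<Rightarrow> real" where "pp a = (a/4) / (1 - a/2)"
definition qq :: "real \<Rightarrow> real" where "qq a = (a/4) / (1 + a/2)"
definition rr :: "real \<Rightarrow> real" where
  "rr a = cc a * (a - cc a) / (2 * (1 - (cc a)^2))"
definition alpha :: "real \<Rightarrow> real" where
  "alpha a = ln (a/16) / ln ((cc a + rr a) / (1 + cc a * rr a))"
definition KK :: "real \<Rightarrow> real" where
  "KK a = (let c = cc a; s = sqrt (1 + c^2 - a*c) in
     min ((1 + c - a*c) powr (pp a) * s powr (1 - pp a))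
         ((1 + c) powr (qq a) * s powr (1 - qq a)))"
definition N0 :: "real \<Rightarrow> real" where "N0 a = 32 * ln (40 / a^2) / a^2"
definition N1 :: "real \<Rightarrow> real" where "N1 a = max (9 * ((4 + 2*a)/a)^2) (N0 a)"
definition N2 :: "real \<Rightarrow> real \<Rightarrow> real" where
  "N2 a c = max (9 * (ln (a/16) / ln (c / (1 + a)))^2) (N0 a)"
definition N3 :: "real \<Rightarrow> real" where
  "N3 a = (let c = cc a in max (N0 a)
     ((ln ((1 + a)/(a - c)) + ln ((1 - a*c)/(1 - c)) - alpha a * ln (rr a)) / ln (KK a) + 1))"

end

theory Submission
  imports Defs "HOL-Computational_Algebra.Fundamental_Theorem_Algebra"
begin

text \<open>
  Suppose that all critical points \<open>w\<close> of \<open>P\<close> satisfy \<open>\<bar>w - a\<bar> > 1\<close>; by Gauss--Lucas they lie in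
  the lune \<open>\<bar>w\<bar> \<le> 1 < \<bar>w - a\<bar>\<close>. Write \<open>P x = P' a * (x - a) * (\<integral>s\<in>[0,1]. \<Prod>j. 1 - s + s * y j)\<close> with
  \<open>y j = (x - w j) / (a - w j)\<close>. Walsh's coincidence theorem replaces the \<open>y j\<close> by a single \<open>y\<close> in
  any disc around 0 that contains them, which turns the integral into \<open>(1 + y + \<dots> + y ^ (n - 1)) / n\<close>.
  For real \<open>x\<close> between 0 and \<open>a\<close> this bounds \<open>\<bar>P x\<bar>\<close> from both sides, and it shows that \<open>P\<close> has no
  zero near \<open>c\<close>. The lower bound at \<open>a / 4\<close> forces the mean real part of the zeros, hence of the
  critical points, to be at most \<open>a / 4\<close>; then \<open>P'\<close> is tiny on \<open>[0, a / 2]\<close>, so that \<open>P 0\<close> is not small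
  and the zeros have product of modulus at least 1/10.

  Finally compare \<open>\<Prod>j. \<bar>1 - c * w j\<bar>\<close>, which is at least \<open>K' ^ (n - 1)\<close> by concavity of the logarithm,
  with \<open>\<Prod>k. \<bar>1 - c * z k\<bar>\<close>, which is \<open>\<bar>P c\<bar>\<close> divided by the Blaschke product of the zeros at \<open>c\<close>.
  Each factor of the latter is at least \<open>\<bar>z k\<bar> powr \<kappa>\<close>, so the product stays bounded, which
  contradicts \<open>K' > 1\<close> once \<open>n\<close> is large.
\<close>

section \<open>Polar derivatives and Walsh's coincidence theorem\<close>

lemma complex_poly_linear_factors:
  fixes p :: "complex poly"
  assumes "p \<noteq> 0"
  obtains w where "p = smult (lead_coeff p) (\<Prod>j<degree p. [:- w j, 1:])"
proof -
  obtain A where A: "size A = degree p" "p = smult (lead_coeff p) (\<Prod>x\<in>#A. [:-x, 1:])"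
    using alg_closed_imp_factorization[OF assms] by blast
  obtain xs where xs: "mset xs = A" using ex_mset by blast
  have "(\<Prod>x\<in>#A. [:-x, 1:]) = prod_list (map (\<lambda>x. [:-x, 1:]) xs)"
    by (simp add: xs[symmetric] flip: prod_mset_prod_list)
  also have "\<dots> = (\<Prod>j<length xs. [:- (xs ! j), 1:])"
    by (simp add: prod.list_conv_set_nth atLeast0LessThan)
  also have "length xs = degree p" using A xs by auto
  finally show thesis using that[of "\<lambda>j. xs ! j"] A(2) by argo
qed

text \<open>The logarithmic derivative. It serves three times: for polar derivatives, for
  Gauss--Lucas, and at the reflected point \<open>1 / c\<close>.\<close>

lemma poly_pderiv_linear_factors:
  fixes w :: "'b \<Rightarrow> complex"
  assumes "finite A" "\<And>j. j \<in> A \<Longrightarrow> z \<noteq> w j"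
  shows "poly (pderiv (smult k (\<Prod>j\<in>A. [:- w j, 1:]))) z
    = poly (smult k (\<Prod>j\<in>A. [:- w j, 1:])) z * (\<Sum>j\<in>A. 1 / (z - w j))"
  using assms
proof (induction A rule: finite_induct)
  case empty
  then show ?case by (simp add: pderiv_smult)
next
  case (insert x F)
  then have "z - w x \<noteq> 0" by simp
  then have "(z - w x) * (1 / (z - w x)) = 1" by simp
  let ?p = "\<Prod>j\<in>F. [:- w j, 1:]"
  from insert have IH: "k * poly (pderiv ?p) z = k * poly ?p z * (\<Sum>j\<in>F. 1 / (z - w j))"
    by (simp add: pderiv_smult)
  have "poly (pderiv (smult k (\<Prod>j\<in>insert x F. [:- w j, 1:]))) z
      = (z - w x) * (k * poly (pderiv ?p) z) + k * poly ?p z"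
    using insert.hyps
    by (simp add: pderiv_smult pderiv_mult pderiv_pCons algebra_simps del: mult_pCons_left)
  also have "\<dots> = k * poly ?p z * ((z - w x) * (\<Sum>j\<in>insert x F. 1 / (z - w j)))"
    using insert.hyps \<open>(z - w x) * (1 / (z - w x)) = 1\<close>
    unfolding IH by (simp add: distrib_left)
  also have "\<dots> = poly (smult k (\<Prod>j\<in>insert x F. [:- w j, 1:])) z * (\<Sum>j\<in>insert x F. 1 / (z - w j))"
    using insert.hyps by (simp only: prod.insert poly_smult poly_mult mult.assoc) (simp add: mult_ac left_diff_distrib right_diff_distrib)
  finally show ?case .
qed

text \<open>Given \<open>z\<close> in the disc of radius \<open>T\<close>, the image of the outside of the disc under
  \<open>\<zeta> \<mapsto> 1 / (z - \<zeta>)\<close> is the superlevel set of a concave function, hence convex.\<close>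

lemma convex_inverse_outside_disc:
  fixes z :: complex
  assumes "cmod z < T"
  shows "convex {t. T * cmod t \<le> cmod (z * t - 1)}"
proof -
  have "{t. T * cmod t \<le> cmod (z * t - 1)}
      = {t. (T\<^sup>2 - (cmod z)\<^sup>2) * (cmod t)\<^sup>2 + 2 * Re (z * t) \<le> 1}"
  proof (intro Collect_cong)
    fix t
    have "T * cmod t \<le> cmod (z * t - 1) \<longleftrightarrow> (T * cmod t)\<^sup>2 \<le> (cmod (z * t - 1))\<^sup>2"
      using assms by (smt (verit) mult_nonneg_nonneg norm_ge_zero power_mono power2_le_imp_le)
    also have "(cmod (z * t - 1))\<^sup>2 = (cmod z)\<^sup>2 * (cmod t)\<^sup>2 - 2 * Re (z * t) + 1"
      unfolding cmod_power2 by (simp add: algebra_simps power2_eq_square)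
    finally show "T * cmod t \<le> cmod (z * t - 1)
        \<longleftrightarrow> (T\<^sup>2 - (cmod z)\<^sup>2) * (cmod t)\<^sup>2 + 2 * Re (z * t) \<le> 1"
      by (simp add: algebra_simps power_mult_distrib)
  qed
  also have "convex \<dots>"
  proof (rule convexI)
    fix x y :: complex and u v :: real
    let ?q = "\<lambda>t. (T\<^sup>2 - (cmod z)\<^sup>2) * (cmod t)\<^sup>2 + 2 * Re (z * t)"
    assume xy: "x \<in> {t. ?q t \<le> 1}" "y \<in> {t. ?q t \<le> 1}" and uv: "0 \<le> u" "0 \<le> v" "u + v = 1"
    have "(cmod z)\<^sup>2 \<le> T\<^sup>2" using assms by (simp add: power_mono)
    have v: "v = 1 - u" using uv by simp
    have "u * (cmod x)\<^sup>2 + v * (cmod y)\<^sup>2 - (cmod (u *\<^sub>R x + v *\<^sub>R y))\<^sup>2 = u * v * (cmod (x - y))\<^sup>2"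
      unfolding cmod_power2 v by (simp add: algebra_simps power2_eq_square)
    then have "(cmod (u *\<^sub>R x + v *\<^sub>R y))\<^sup>2 \<le> u * (cmod x)\<^sup>2 + v * (cmod y)\<^sup>2"
      using uv by (smt (verit) mult_nonneg_nonneg zero_le_power2)
    then have "?q (u *\<^sub>R x + v *\<^sub>R y) \<le> (T\<^sup>2 - (cmod z)\<^sup>2) * (u * (cmod x)\<^sup>2 + v * (cmod y)\<^sup>2)
        + 2 * Re (z * (u *\<^sub>R x + v *\<^sub>R y))"
      using \<open>(cmod z)\<^sup>2 \<le> T\<^sup>2\<close> by (simp add: mult_left_mono)
    also have "\<dots> = u * ?q x + v * ?q y" by (simp add: algebra_simps)
    also have "\<dots> \<le> u * 1 + v * 1"
      using xy uv by (intro add_mono mult_left_mono) auto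
    finally show "u *\<^sub>R x + v *\<^sub>R y \<in> {t. ?q t \<le> 1}" using uv by simp
  qed
  finally show ?thesis .
qed

lemma poly_altdef_le:
  fixes p :: "'a :: comm_semiring_1 poly"
  assumes "degree p \<le> N"
  shows "poly p x = (\<Sum>i\<le>N. coeff p i * x ^ i)"
  unfolding poly_altdef using assms
  by (intro sum.mono_neutral_left) (auto simp: coeff_eq_0)

text \<open>If the polar derivative vanished, the mean of the \<open>N\<close> numbers
  \<open>1 / (z - w j)\<close> would be \<open>1 / (z - u)\<close>. That mean lies in the convex
  image of the outside of the disc, whereas \<open>u\<close> is inside.\<close>

lemma laguerre_polar_derivative:
  fixes p :: "complex poly"
  assumes deg: "degree p \<le> N" "0 < N"
    and nz: "\<And>z. cmod z < T \<Longrightarrow> poly p z \<noteq> 0"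
    and u: "cmod u < T" and z: "cmod z < T"
  shows "of_nat N * poly p z + (u - z) * poly (pderiv p) z \<noteq> 0"
proof
  assume eq: "of_nat N * poly p z + (u - z) * poly (pderiv p) z = 0"
  have pz: "poly p z \<noteq> 0" using nz z by blast
  then have p0: "p \<noteq> 0" by auto
  obtain w where w: "p = smult (lead_coeff p) (\<Prod>j<degree p. [:- w j, 1:])"
    by (rule complex_poly_linear_factors[OF p0])
  have root: "poly p (w j) = 0" if "j < degree p" for j
    by (subst w) (use that in \<open>auto simp: poly_prod\<close>)
  have wT: "T \<le> cmod (w j)" if "j < degree p" for j
    using nz[of "w j"] root[OF that] by force
  have zw: "z \<noteq> w j" if "j \<in> {..<degree p}" for j
    using wT z that by force
  define S where "S = {t. T * cmod t \<le> cmod (z * t - 1)}"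
  \<comment> \<open>When the degree is below \<open>N\<close>, the missing roots sit at infinity,
    where \<open>1 / (z - w)\<close> takes the value 0; the set \<open>S\<close> contains 0.\<close>
  define t where "t j = (if j < degree p then 1 / (z - w j) else 0)" for j
  have "poly (pderiv p) z = poly p z * (\<Sum>j<degree p. 1 / (z - w j))"
    using poly_pderiv_linear_factors[of "{..<degree p}" z w "lead_coeff p", OF finite_lessThan zw]
    unfolding w[symmetric] .
  also have "(\<Sum>j<degree p. 1 / (z - w j)) = (\<Sum>j<N. t j)"
    using deg by (intro sum.mono_neutral_cong_left) (auto simp: t_def)
  finally have "poly p z * (of_nat N + (u - z) * (\<Sum>j<N. t j)) = 0"
    using eq by (simp add: algebra_simps)
  then have "of_nat N + (u - z) * (\<Sum>j<N. t j) = 0" using pz by simp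
  then have s: "(z - u) * (\<Sum>j<N. t j) = of_nat N" by (simp add: algebra_simps)
  define t0 where "t0 = (\<Sum>j<N. (1 / real N) *\<^sub>R t j)"
  have "t0 \<in> S" unfolding t0_def
  proof (rule convex_sum)
    show "convex S" unfolding S_def by (rule convex_inverse_outside_disc[OF z])
    show "t j \<in> S" if "j \<in> {..<N}" for j
    proof (cases "j < degree p")
      case True
      then have "z - w j \<noteq> 0" using zw by auto
      then have "z * t j - 1 = w j * t j" using True by (simp add: t_def field_simps)
      then show ?thesis using wT[OF True] by (simp add: S_def norm_mult mult_right_mono)
    qed (simp add: S_def t_def)
  qed (use deg in auto)
  moreover have "(z - u) * t0 = 1"
    using s deg by (simp add: t0_def scaleR_conv_of_real flip: sum_divide_distrib)
  then have "z * t0 - 1 = u * t0" "t0 \<noteq> 0" by (auto simp: algebra_simps)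
  ultimately have "T * cmod t0 \<le> cmod u * cmod t0" "0 < cmod t0"
    unfolding S_def by (auto simp: norm_mult)
  then show False using u by simp
qed

text \<open>\<open>polarize N u c\<close> is the value at \<open>u 0, \<dots>, u (N - 1)\<close> of the symmetric multiaffine form
  whose diagonal is \<open>\<Sum>i\<le>N. (N choose i) * c i * z ^ i\<close>; plugging in one argument
  amounts to taking a polar derivative.\<close>

primrec polarize :: "nat \<Rightarrow> (nat \<Rightarrow> complex) \<Rightarrow> (nat \<Rightarrow> complex) \<Rightarrow> complex" where
  "polarize 0 u c = c 0"
| "polarize (Suc N) u c = polarize N u (\<lambda>i. c i + u N * c (Suc i))"

lemma polarize_cong:
  "(\<And>i. i \<le> N \<Longrightarrow> c i = c' i) \<Longrightarrow> polarize N u c = polarize N u c'"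
proof (induction N arbitrary: c c')
  case (Suc N)
  show ?case by (simp, rule Suc.IH) (simp add: Suc.prems)
qed simp

text \<open>With coefficients scaled by binomials, the polar derivative with pole \<open>u\<close>
  turns \<open>c i\<close> into \<open>c i + u * c (Suc i)\<close>, which is the recursion step of
  \<open>polarize\<close>. Absorption and Pascal's rule give it.\<close>

lemma polar_derivative_binomial_form:
  fixes c :: "nat \<Rightarrow> complex"
  shows "of_nat (Suc N) * (\<Sum>i\<le>Suc N. of_nat (Suc N choose i) * c i * z ^ i)
      + (u - z) * (\<Sum>i\<le>N. of_nat (Suc i) * (of_nat (Suc N choose Suc i) * c (Suc i)) * z ^ i)
    = of_nat (Suc N) * (\<Sum>i\<le>N. of_nat (N choose i) * (c i + u * c (Suc i)) * z ^ i)"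
proof -
  have absorb: "of_nat (Suc i) * of_nat (Suc N choose Suc i)
      = (of_nat (Suc N) * of_nat (N choose i) :: complex)" for i
    using Suc_times_binomial_eq[of N i] by (metis mult.commute of_nat_mult)
  have D: "(\<Sum>i\<le>N. of_nat (Suc i) * (of_nat (Suc N choose Suc i) * c (Suc i)) * z ^ i)
      = of_nat (Suc N) * (\<Sum>i\<le>N. of_nat (N choose i) * c (Suc i) * z ^ i)"
    unfolding sum_distrib_left
    by (simp only: mult.assoc[symmetric] absorb)
  have pascal: "(\<Sum>i\<le>Suc N. of_nat (Suc N choose i) * c i * z ^ i)
      = (\<Sum>i\<le>N. of_nat (N choose i) * c i * z ^ i)
        + z * (\<Sum>i\<le>N. of_nat (N choose i) * c (Suc i) * z ^ i)"
  proof -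
    \<comment> \<open>The extra top term carries \<open>N choose Suc N = 0\<close>; with equal
      ranges, Pascal's rule applies after an index shift.\<close>
    have "(\<Sum>i\<le>N. of_nat (N choose i) * c i * z ^ i) = (\<Sum>i\<le>Suc N. of_nat (N choose i) * c i * z ^ i)"
      by simp
    then show ?thesis
      by (simp add: sum.atMost_Suc_shift sum_distrib_left sum.distrib algebra_simps
          del: sum.atMost_Suc)
  qed
  have R: "(\<Sum>i\<le>N. of_nat (N choose i) * (c i + u * c (Suc i)) * z ^ i)
      = (\<Sum>i\<le>N. of_nat (N choose i) * c i * z ^ i)
        + u * (\<Sum>i\<le>N. of_nat (N choose i) * c (Suc i) * z ^ i)"
    by (simp add: sum.distrib sum_distrib_left algebra_simps)
  show ?thesis unfolding D pascal R by (simp only: algebra_simps)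
qed

text \<open>Each argument of the form is plugged in by one polar derivative, and Laguerre's theorem
  keeps the disc free of zeros at every stage.\<close>

lemma grace_polarize:
  assumes "\<And>z. cmod z < T \<Longrightarrow> (\<Sum>i\<le>N. of_nat (N choose i) * c i * z ^ i) \<noteq> 0"
    and "\<And>j. j < N \<Longrightarrow> cmod (u j) < T" and "0 < T"
  shows "polarize N u c \<noteq> 0"
  using assms
proof (induction N arbitrary: c)
  case 0
  from "0.prems"(1)[of 0] "0.prems"(3) show ?case by simp
next
  case (Suc N)
  let ?a = "\<lambda>i. of_nat (Suc N choose i) * c i"
  define p where "p = Poly (map ?a [0..<Suc (Suc N)])"
  have coeff: "coeff p i = (if i \<le> Suc N then ?a i else 0)" for i
    by (auto simp: p_def coeff_Poly_eq nth_default_def simp del: upt_Suc)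
  have deg: "degree p \<le> Suc N" by (rule degree_le) (simp add: coeff)
  have p: "poly p z = (\<Sum>i\<le>Suc N. ?a i * z ^ i)" for z
    using poly_altdef_le[OF deg, of z] by (simp add: coeff)
  have deg': "degree (pderiv p) \<le> N" using deg by (simp add: degree_pderiv)
  have p': "poly (pderiv p) z = (\<Sum>i\<le>N. of_nat (Suc i) * ?a (Suc i) * z ^ i)" for z
    using poly_altdef_le[OF deg', of z] by (simp add: coeff coeff_pderiv)
  show ?case unfolding polarize.simps
  proof (rule Suc.IH)
    fix z assume z: "cmod z < T"
    have "of_nat (Suc N) * poly p z + (u N - z) * poly (pderiv p) z \<noteq> 0"
      using deg Suc.prems z by (intro laguerre_polar_derivative[of _ _ T]) (auto simp: p)
    then show "(\<Sum>i\<le>N. of_nat (N choose i) * (c i + u N * c (Suc i)) * z ^ i) \<noteq> 0"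
      unfolding p p' polar_derivative_binomial_form by auto
  qed (use Suc.prems in auto)
qed

text \<open>These moments are the coefficients of the integral of
  \<open>h s * (1 - s + s * z) ^ N\<close>, shifted by \<open>v\<close>; the polar form gives each
  factor its own argument. The weight \<open>h\<close> is general so that the induction can absorb
  the factor of \<open>u N\<close>. The shift sits at index 0 and is never multiplied by an
  argument.\<close>

lemma polarize_moments:
  fixes h :: "real \<Rightarrow> complex"
  assumes "continuous_on {0..1} h"
  shows "polarize N u (\<lambda>i. integral {0..1} (\<lambda>s. h s * of_real ((1 - s) ^ (N - i) * s ^ i))
        - (if i = 0 then v else 0))
    = integral {0..1} (\<lambda>s. h s * (\<Prod>j<N. of_real (1 - s) + of_real s * u j)) - v"
  using assms
proof (induction N arbitrary: h)
  case 0
  then show ?case by simp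
next
  case (Suc N)
  let ?h = "\<lambda>s. h s * (of_real (1 - s) + of_real s * u N)"
  have cont: "continuous_on {0..1} ?h" by (intro continuous_intros Suc.prems)
  have "polarize (Suc N) u (\<lambda>i. integral {0..1} (\<lambda>s. h s * of_real ((1 - s) ^ (Suc N - i) * s ^ i))
        - (if i = 0 then v else 0))
    = polarize N u (\<lambda>i. integral {0..1} (\<lambda>s. ?h s * of_real ((1 - s) ^ (N - i) * s ^ i))
        - (if i = 0 then v else 0))"
    unfolding polarize.simps
  proof (rule polarize_cong)
    fix i assume i: "i \<le> N"
    have int: "(\<lambda>s. h s * of_real ((1 - s) ^ k * s ^ l)) integrable_on {0..1}" for k l
      by (intro integrable_continuous_interval continuous_intros Suc.prems)
    have "integral {0..1} (\<lambda>s. h s * of_real ((1 - s) ^ (Suc N - i) * s ^ i))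
        + u N * integral {0..1} (\<lambda>s. h s * of_real ((1 - s) ^ (Suc N - Suc i) * s ^ Suc i))
      = integral {0..1} (\<lambda>s. h s * of_real ((1 - s) ^ (Suc N - i) * s ^ i)
          + u N * (h s * of_real ((1 - s) ^ (Suc N - Suc i) * s ^ Suc i)))"
      by (simp only: integral_add[OF int integrable_on_mult_right[OF int]] integral_mult_right)
    also have "\<dots> = integral {0..1} (\<lambda>s. ?h s * of_real ((1 - s) ^ (N - i) * s ^ i))"
      by (rule integral_cong) (simp add: Suc_diff_le i algebra_simps)
    finally show "integral {0..1} (\<lambda>s. h s * of_real ((1 - s) ^ (Suc N - i) * s ^ i))
        - (if i = 0 then v else 0)
        + u N * (integral {0..1} (\<lambda>s. h s * of_real ((1 - s) ^ (Suc N - Suc i) * s ^ Suc i))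
        - (if Suc i = 0 then v else 0))
      = integral {0..1} (\<lambda>s. ?h s * of_real ((1 - s) ^ (N - i) * s ^ i)) - (if i = 0 then v else 0)"
      by simp
  qed
  also have "\<dots> = integral {0..1} (\<lambda>s. ?h s * (\<Prod>j<N. of_real (1 - s) + of_real s * u j)) - v"
    by (rule Suc.IH[OF cont])
  also have "\<dots> = integral {0..1} (\<lambda>s. h s * (\<Prod>j<Suc N. of_real (1 - s) + of_real s * u j)) - v"
    by (simp add: algebra_simps)
  finally show ?case .
qed

lemma integral_affine_power:
  fixes z :: complex
  assumes "z \<noteq> 1"
  shows "integral {0..1} (\<lambda>s. (of_real (1 - s) + of_real s * z) ^ N) = (\<Sum>k\<le>N. z ^ k) / of_nat (Suc N)"
proof -
  let ?F = "\<lambda>s. (of_real (1 - s) + of_real s * z) ^ Suc N / (of_nat (Suc N) * (z - 1))"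
  have nz: "of_nat (Suc N) * (z - 1) \<noteq> 0" using assms by (simp del: of_nat_Suc)
  have "((\<lambda>s. (of_real (1 - s) + of_real s * z) ^ N) has_integral (?F 1 - ?F 0)) {0..1}"
  proof (rule fundamental_theorem_of_calculus)
    fix s :: real
    have "((\<lambda>s. 1 - s + s * z) has_field_derivative (z - 1)) (at (of_real s))"
      by (auto intro!: derivative_eq_intros)
    from DERIV_cdivide[OF DERIV_power[OF this, of "Suc N"], of "of_nat (Suc N) * (z - 1)"]
    have "((\<lambda>s. (1 - s + s * z) ^ Suc N / (of_nat (Suc N) * (z - 1))) has_field_derivative
        (of_nat (Suc N) * (z - 1) * (1 - of_real s + of_real s * z) ^ N) / (of_nat (Suc N) * (z - 1)))
        (at (of_real s))"
      by (simp only: diff_Suc_Suc diff_zero mult.assoc)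
    then have "((\<lambda>s. (1 - s + s * z) ^ Suc N / (of_nat (Suc N) * (z - 1))) has_field_derivative
        (of_real (1 - s) + of_real s * z) ^ N) (at (of_real s))"
      using nz by (simp del: of_nat_Suc power_Suc)
    from has_vector_derivative_real_field[OF this]
    show "(?F has_vector_derivative (of_real (1 - s) + of_real s * z) ^ N) (at s within {0..1})"
      by (simp add: o_def has_vector_derivative_at_within del: of_nat_Suc power_Suc)
  qed simp
  moreover have "?F 1 - ?F 0 = (\<Sum>k\<le>N. z ^ k) / of_nat (Suc N)"
    using assms nz power_diff_1_eq[of z "Suc N"]
    by (simp add: lessThan_Suc_atMost divide_simps del: of_nat_Suc power_Suc)
  ultimately show ?thesis by (metis integral_unique)
qed

text \<open>Let \<open>v\<close> be the integral. If no \<open>y\<close> in the disc gave the value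
  \<open>v\<close>, the diagonal form minus \<open>v\<close> would have no zero there, so by Grace
  the polar form at \<open>u\<close> would not vanish; but by the choice of \<open>v\<close> it
  does.\<close>

lemma walsh_coincidence_integral:
  fixes u :: "nat \<Rightarrow> complex"
  assumes u: "\<And>j. j < N \<Longrightarrow> cmod (u j) < T" and T: "0 < T" "T \<le> 1"
  shows "\<exists>y. cmod y < T \<and>
    integral {0..1} (\<lambda>s. \<Prod>j<N. of_real (1 - s) + of_real s * u j) = (\<Sum>k\<le>N. y ^ k) / of_nat (Suc N)"
proof (rule ccontr)
  assume no: "\<not> ?thesis"
  define v where "v = integral {0..1} (\<lambda>s. \<Prod>j<N. of_real (1 - s) + of_real s * u j)"
  have ne: "(\<Sum>k\<le>N. y ^ k) / of_nat (Suc N) \<noteq> v" if "cmod y < T" for y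
    using that no unfolding v_def by force
  define c where "c i = integral {0..1} (\<lambda>s. 1 * of_real ((1 - s) ^ (N - i) * s ^ i))
      - (if i = 0 then v else 0)" for i
  have "polarize N u c \<noteq> 0"
  proof (rule grace_polarize[OF _ u T(1)])
    fix z assume z: "cmod z < T"
    have "(\<Sum>i\<le>N. of_nat (N choose i) * c i * z ^ i)
      = (\<Sum>i\<le>N. of_nat (N choose i) * z ^ i * integral {0..1} (\<lambda>s. of_real ((1 - s) ^ (N - i) * s ^ i)))
        - (\<Sum>i\<le>N. if i = 0 then v else 0)"
      unfolding sum_subtractf[symmetric]
      by (intro sum.cong refl) (auto simp: c_def algebra_simps)
    also have "(\<Sum>i\<le>N. if i = 0 then v else 0) = v" by simp
    also have "(\<Sum>i\<le>N. of_nat (N choose i) * z ^ i * integral {0..1} (\<lambda>s. of_real ((1 - s) ^ (N - i) * s ^ i)))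
      = (\<Sum>i\<le>N. integral {0..1} (\<lambda>s. of_nat (N choose i) * z ^ i * of_real ((1 - s) ^ (N - i) * s ^ i)))"
      by (simp del: of_real_mult of_real_power)
    also have "\<dots> = integral {0..1} (\<lambda>s. \<Sum>i\<le>N. of_nat (N choose i) * z ^ i * of_real ((1 - s) ^ (N - i) * s ^ i))"
      by (rule integral_sum[symmetric])
        (auto intro!: integrable_continuous_interval continuous_intros)
    also have "\<dots> = integral {0..1} (\<lambda>s. (of_real (1 - s) + of_real s * z) ^ N)"
    proof (rule integral_cong)
      fix s :: real
      have "(of_real (1 - s) + of_real s * z) ^ N = (of_real s * z + of_real (1 - s)) ^ N"
        by (simp only: add.commute)
      then show "(\<Sum>i\<le>N. of_nat (N choose i) * z ^ i * of_real ((1 - s) ^ (N - i) * s ^ i))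
          = (of_real (1 - s) + of_real s * z) ^ N"
        unfolding binomial_ring by (simp add: power_mult_distrib mult_ac)
    qed
    \<comment> \<open>The bound \<open>T \<le> 1\<close> keeps \<open>z\<close> away from 1, where
      the antiderivative would divide by 0.\<close>
    also have "\<dots> = (\<Sum>k\<le>N. z ^ k) / of_nat (Suc N)"
      using z T by (intro integral_affine_power) auto
    finally show "(\<Sum>i\<le>N. of_nat (N choose i) * c i * z ^ i) \<noteq> 0"
      using ne[OF z] by simp
  qed
  moreover have "polarize N u c = 0"
    using polarize_moments[of "\<lambda>_. 1" N u v] unfolding c_def v_def by simp
  ultimately show False by contradiction
qed

section \<open>Critical points of a counterexample\<close>

lemma monic_linear_factors:
  fixes w :: "nat \<Rightarrow> 'a :: idom"
  shows "degree (\<Prod>j<N. [:- w j, 1:]) = N" "coeff (\<Prod>j<N. [:- w j, 1:]) N = 1"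
proof -
  show deg: "degree (\<Prod>j<N. [:- w j, 1:]) = N"
    by (subst degree_prod_eq_sum_degree) auto
  show "coeff (\<Prod>j<N. [:- w j, 1:]) N = 1"
    using lead_coeff_prod[of "\<lambda>j. [:- w j, 1:]" "{..<N}"] unfolding deg by simp
qed

lemma subleading_coeff_linear_factors:
  fixes w :: "nat \<Rightarrow> 'a :: idom"
  shows "coeff (\<Prod>j<Suc N. [:- w j, 1:]) N = - (\<Sum>j<Suc N. w j)"
proof (induction N)
  case (Suc N)
  let ?q = "\<Prod>j<Suc N. [:- w j, 1:]"
  have "(\<Prod>j<Suc (Suc N). [:- w j, 1:]) = [:- w (Suc N), 1:] * ?q"
    by (subst prod.lessThan_Suc) (rule mult.commute)
  then have "coeff (\<Prod>j<Suc (Suc N). [:- w j, 1:]) (Suc N)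
      = coeff ?q N - w (Suc N) * coeff ?q (Suc N)"
    by (simp del: prod.lessThan_Suc)
  then show ?case unfolding Suc monic_linear_factors(2) by simp
qed simp

text \<open>Outside the disc every term \<open>w / (w - z k)\<close> has positive real part, so the
  logarithmic derivative cannot vanish.\<close>

lemma gauss_lucas_unit_disc:
  fixes z :: "nat \<Rightarrow> complex"
  assumes "0 < N" "\<And>k. k < N \<Longrightarrow> cmod (z k) \<le> 1"
    and w: "poly (pderiv (\<Prod>k<N. [:- z k, 1:])) w = 0"
  shows "cmod w \<le> 1"
proof (rule ccontr)
  assume "\<not> cmod w \<le> 1"
  then have w1: "1 < cmod w" by simp
  have wz: "w \<noteq> z k" if "k \<in> {..<N}" for k using assms(2)[of k] that w1 by auto
  have "poly (\<Prod>k<N. [:- z k, 1:]) w \<noteq> 0"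
    using wz by (simp add: poly_prod)
  then have s: "(\<Sum>k<N. 1 / (w - z k)) = 0"
    using w poly_pderiv_linear_factors[of "{..<N}" w z 1, OF finite_lessThan wz] by simp
  have pos: "0 < Re (w * (1 / (w - z k)))" if "k < N" for k
  proof -
    have "Re (z k * cnj w) \<le> cmod (z k) * cmod w"
      using complex_Re_le_cmod[of "z k * cnj w"] by (simp add: norm_mult)
    also have "\<dots> \<le> 1 * cmod w" using assms(2)[OF that] by (intro mult_right_mono) auto
    also have "\<dots> < (cmod w)\<^sup>2"
      using power_strict_increasing[of 1 2 "cmod w"] w1 by simp
    finally have "Re (cnj w * (w - z k)) > 0"
      unfolding cmod_power2 by (simp add: algebra_simps power2_eq_square)
    then have "0 < Re (w * cnj (w - z k))" by (simp add: algebra_simps)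
    moreover have "w - z k \<noteq> 0" using wz that by auto
    ultimately show ?thesis
      using complex_div_cnj[of w "w - z k"] by (simp del: complex_cnj_diff add: Re_divide_of_real flip: of_real_power)
  qed
  have "0 < (\<Sum>k<N. Re (w * (1 / (w - z k))))"
    using assms(1) pos by (intro sum_pos) auto
  also have "\<dots> = Re (w * (\<Sum>k<N. 1 / (w - z k)))"
    by (simp add: sum_distrib_left)
  finally show False using s by simp
qed

text \<open>The negated conclusion is \<open>far\<close>. The zero \<open>a\<close> has index 0, so
  the other zeros are indexed by \<open>1..m\<close>, while the \<open>m\<close> critical points are
  indexed from 0.\<close>

locale sendov_counterexample =
  fixes a :: real and n m :: nat and Z w :: "nat \<Rightarrow> complex" and P :: "complex poly"
  assumes a: "0 < a" "a < 1" and n: "n = Suc m" and m: "0 < m"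
    and P: "P = (\<Prod>k<n. [:- Z k, 1:])" and Z0: "Z 0 = of_real a"
    and Z: "\<And>k. k < n \<Longrightarrow> cmod (Z k) \<le> 1"
    and P': "pderiv P = smult (of_nat n) (\<Prod>j<m. [:- w j, 1:])"
    and far: "\<And>j. j < m \<Longrightarrow> 1 < cmod (of_real a - w j)"
begin

abbreviation F :: "complex \<Rightarrow> complex" where "F \<equiv> poly P"
abbreviation F' :: "complex \<Rightarrow> complex" where "F' \<equiv> poly (pderiv P)"

lemma F_eq: "F x = (\<Prod>k<n. x - Z k)" by (simp add: P poly_prod)

lemma F'_eq: "F' x = of_nat n * (\<Prod>j<m. x - w j)" by (simp add: P' poly_prod)

lemma n_pos: "0 < n" using n by simp

lemma F_a: "F (of_real a) = 0"
  unfolding F_eq using Z0 n_pos by (auto intro!: bexI[of _ 0])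

lemma w_disc: "j < m \<Longrightarrow> cmod (w j) \<le> 1"
  by (rule gauss_lucas_unit_disc[of n Z]) (auto simp: n_pos Z F'_eq simp flip: P)

text \<open>Zeros and critical points have the same centroid: compare the subleading coefficients of
  \<open>P\<close> and of its derivative.\<close>

lemma sum_critical: "of_nat n * (\<Sum>j<m. w j) = of_nat m * (\<Sum>k<n. Z k)"
proof -
  obtain l where l: "m = Suc l" using m gr0_conv_Suc by blast
  have "coeff (pderiv P) l = of_nat m * coeff P m"
    by (simp add: coeff_pderiv l)
  also have "coeff P m = - (\<Sum>k<n. Z k)"
    unfolding P n by (rule subleading_coeff_linear_factors)
  also have "coeff (pderiv P) l = - (of_nat n * (\<Sum>j<m. w j))"
    unfolding P' l coeff_smult subleading_coeff_linear_factors
    by (simp del: sum.lessThan_Suc)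
  finally show ?thesis by simp
qed

text \<open>The logarithmic derivative at \<open>1 / c\<close>, the mirror image of \<open>c\<close>
  in the unit circle, with powers of \<open>c\<close> cleared. The extra \<open>c\<close> from the
  sum matches \<open>n = Suc m\<close>.\<close>

lemma prod_reflected_critical:
  assumes c: "0 < c" "c < 1"
  shows "of_nat n * (\<Prod>j<m. 1 - of_real c * w j)
    = (\<Prod>k<n. 1 - of_real c * Z k) * (\<Sum>k<n. 1 / (1 - of_real c * Z k))"
proof -
  let ?c = "complex_of_real c"
  have c0: "?c \<noteq> 0" using c by simp
  have ne: "1 / ?c \<noteq> Z k" if "k \<in> {..<n}" for k
  proof
    assume "1 / ?c = Z k"
    then have "cmod (1 / ?c) \<le> 1" using Z[of k] that by simp
    then show False using c by (simp add: norm_divide field_simps)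
  qed
  have scale: "(\<Prod>j<N. 1 - ?c * v j) = ?c ^ N * (\<Prod>j<N. 1 / ?c - v j)" for N v
  proof -
    have "?c ^ N * (\<Prod>j<N. 1 / ?c - v j) = (\<Prod>j<N. ?c * (1 / ?c - v j))"
      by (simp add: prod.distrib)
    also have "\<dots> = (\<Prod>j<N. 1 - ?c * v j)"
      using c0 by (intro prod.cong) (auto simp: right_diff_distrib)
    finally show ?thesis by simp
  qed
  have "F' (1 / ?c) = F (1 / ?c) * (\<Sum>k<n. 1 / (1 / ?c - Z k))"
    using poly_pderiv_linear_factors[of "{..<n}" "1 / ?c" Z 1, OF finite_lessThan ne]
    by (simp add: P)
  also have "(\<Sum>k<n. 1 / (1 / ?c - Z k)) = (\<Sum>k<n. ?c * (1 / (1 - ?c * Z k)))"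
    using c0 by (intro sum.cong) (auto simp: field_simps)
  finally have "F' (1 / ?c) = F (1 / ?c) * (?c * (\<Sum>k<n. 1 / (1 - ?c * Z k)))"
    by (simp only: sum_distrib_left)
  then show ?thesis unfolding scale
    unfolding F'_eq F_eq n by (simp add: mult_ac)
qed

lemma F_coincidence:
  assumes x: "\<And>j. j < m \<Longrightarrow> cmod (x - w j) < T * cmod (of_real a - w j)" and T: "0 < T" "T \<le> 1"
  shows "\<exists>y. cmod y < T \<and> F x = F' (of_real a) * (x - of_real a) * (\<Sum>k<n. y ^ k) / of_nat n"
proof -
  let ?a = "complex_of_real a"
  define u where "u j = (x - w j) / (?a - w j)" for j
  have nz: "?a - w j \<noteq> 0" if "j < m" for j using far[OF that] by auto
  have "cmod (u j) < T" if "j < m" for j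
    using x[OF that] nz[OF that] by (simp add: u_def norm_divide field_simps)
  then obtain y where y: "cmod y < T"
    "integral {0..1} (\<lambda>s. \<Prod>j<m. of_real (1 - s) + of_real s * u j) = (\<Sum>k\<le>m. y ^ k) / of_nat (Suc m)"
    using walsh_coincidence_integral[OF _ T] by blast
  let ?g = "\<lambda>s::real. (x - ?a) * F' (?a) * (\<Prod>j<m. of_real (1 - s) + of_real s * u j)"
  have "(?g has_integral (F (?a + of_real 1 * (x - ?a)) - F (?a + of_real 0 * (x - ?a)))) {0..1}"
  proof (rule fundamental_theorem_of_calculus)
    fix s :: real
    have "((\<lambda>s. F (?a + s * (x - ?a))) has_field_derivative
        F' (?a + of_real s * (x - ?a)) * (x - ?a)) (at (of_real s))"
      by (rule DERIV_chain2[OF poly_DERIV]) (auto intro!: derivative_eq_intros)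
    moreover have "F' (?a + of_real s * (x - ?a)) * (x - ?a) = ?g s"
    proof -
      \<comment> \<open>On the segment from \<open>a\<close> to \<open>x\<close>, each factor of the
        derivative is \<open>a - w j\<close> times an affine function of \<open>s\<close> running
        from 1 to \<open>u j\<close>; this is the shape that Walsh's theorem handles.\<close>
      have "(?a - w j) * (of_real (1 - s) + of_real s * u j) = ?a + of_real s * (x - ?a) - w j"
        if "j < m" for j
        using nz[OF that] by (simp add: u_def divide_simps) (simp add: algebra_simps)
      then have "(\<Prod>j<m. ?a - w j) * (\<Prod>j<m. of_real (1 - s) + of_real s * u j)
          = (\<Prod>j<m. ?a + of_real s * (x - ?a) - w j)"
        by (simp flip: prod.distrib)
      then show ?thesis unfolding F'_eq by (simp add: mult_ac)
    qed
    ultimately have "((\<lambda>s. F (?a + s * (x - ?a))) has_field_derivative ?g s) (at (of_real s))"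
      by simp
    from has_vector_derivative_real_field[OF this]
    show "((\<lambda>s. F (?a + of_real s * (x - ?a))) has_vector_derivative ?g s) (at s within {0..1})"
      by (simp add: o_def has_vector_derivative_at_within)
  qed simp
  then have "(?g has_integral F x) {0..1}" using F_a by simp
  then have "F x = integral {0..1} ?g" by (rule integral_unique[symmetric])
  also have "\<dots> = (x - ?a) * F' ?a * ((\<Sum>k\<le>m. y ^ k) / of_nat (Suc m))"
    unfolding integral_mult_right y(2) ..
  finally show ?thesis using y(1)
    by (intro exI[of _ y]) (simp add: n lessThan_Suc_atMost mult_ac)
qed

end

section \<open>Geometry of the lune and elementary inequalities\<close>

text \<open>With \<open>d\<close>, \<open>X\<close>, \<open>W\<close> as in the proof, right minus
  left side is \<open>(a - x) * (a + x - 2 * X - x * d)\<close>, and \<open>a\<close> times the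
  second factor is \<open>d * (1 - a * x) - (W - a * x)\<close>, positive since
  \<open>W \<le> 1 < d\<close>.\<close>

lemma lune_dist_less:
  fixes a x :: real and w :: complex
  assumes a: "0 < a" "a < 1" and x: "0 \<le> x" "x < a"
    and w: "cmod w \<le> 1" "1 < cmod (of_real a - w)"
  shows "(cmod (of_real x - w))\<^sup>2 < (1 - x * (a - x)) * (cmod (of_real a - w))\<^sup>2"
proof -
  define d where "d = (cmod (of_real a - w))\<^sup>2"
  define X where "X = Re w"
  define W where "W = (cmod w)\<^sup>2"
  have W: "W \<le> 1" using w by (simp add: W_def power_le_one)
  have d1: "1 < d" using w by (simp add: d_def one_less_power)
  have d: "d = a\<^sup>2 - 2 * a * X + W"
    unfolding d_def X_def W_def cmod_power2 by (simp add: power2_eq_square algebra_simps)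
  have xw: "(cmod (of_real x - w))\<^sup>2 = x\<^sup>2 - 2 * x * X + W"
    unfolding X_def W_def cmod_power2 by (simp add: power2_eq_square algebra_simps)
  have "a * x < 1 * 1" using a x by (intro mult_strict_mono) auto
  then have "1 * (1 - a * x) < d * (1 - a * x)" using d1 by (intro mult_strict_right_mono) auto
  then have "W - a * x < d * (1 - a * x)" using W by (simp only: mult_1)
  then have "0 < a * (a + x - 2 * X - x * d)"
    unfolding d by (simp add: power2_eq_square algebra_simps)
  then have "0 < (a - x) * (a + x - 2 * X - x * d)"
    using a x by (simp add: zero_less_mult_iff)
  then show ?thesis unfolding xw d_def[symmetric]
    by (simp add: d power2_eq_square algebra_simps)
qed

text \<open>Points of the lune are closer to 0 than to \<open>a\<close>, hence to the left of the
  perpendicular bisector.\<close>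

lemma lune_Re_less:
  assumes "0 < a" "cmod w \<le> 1" "1 < cmod (of_real a - w)"
  shows "Re w < a / 2"
proof -
  have "(cmod w)\<^sup>2 < (cmod (of_real a - w))\<^sup>2"
    using assms by (intro power_strict_mono) auto
  also have "\<dots> = a * (a - 2 * Re w) + (cmod w)\<^sup>2"
    unfolding cmod_power2 by (simp add: power2_eq_square algebra_simps)
  finally show ?thesis using assms(1) by (simp add: zero_less_mult_iff)
qed

lemma sqrt_one_minus_le:
  assumes "q \<le> (1::real)"
  shows "sqrt (1 - q) \<le> 1 - q / 2"
proof (rule real_le_lsqrt)
  show "1 - q \<le> (1 - q / 2)\<^sup>2" by (simp add: power2_eq_square algebra_simps)
qed (use assms in auto)

text \<open>Applied with \<open>v = n * a^2 / 32\<close>, this absorbs the factor \<open>n\<close>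
  of the derivative.\<close>

lemma mult_exp_minus_le:
  assumes "3 \<le> (v::real)"
  shows "v * exp (- v) \<le> 1 / 5"
proof -
  have "(5/2::real) \<le> exp 1" using exp_lower_Taylor_quadratic[of 1] by simp
  then have "(5/2::real) ^ 3 \<le> exp 1 ^ 3" by (intro power_mono) auto
  also have "exp 1 ^ 3 = (exp 3 :: real)" by (simp flip: exp_of_nat_mult)
  finally have e3: "15 \<le> exp (3::real)" by (simp add: power3_eq_cube)
  have "v - 2 \<le> exp (v - 3)" using exp_ge_add_one_self[of "v - 3"] by simp
  then have "15 * (v - 2) \<le> exp 3 * exp (v - 3)" using e3 assms by (intro mult_mono) auto
  also have "\<dots> = exp v" by (simp flip: exp_add)
  finally have "5 * v \<le> exp v" using assms by simp
  then show ?thesis by (simp add: exp_minus field_simps)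
qed

section \<open>Values of the polynomial between 0 and a\<close>

context sendov_counterexample
begin

lemma F'_a_ge: "real n \<le> cmod (F' (of_real a))"
proof -
  have "1 \<le> (\<Prod>j<m. cmod (of_real a - w j))"
    using far by (intro prod_ge_1) (auto simp: less_imp_le)
  then show ?thesis unfolding F'_eq norm_mult prod_norm[symmetric]
    by (simp add: mult_le_cancel_left1)
qed

lemma dist_critical_less:
  assumes "0 < x" "x < a" "j < m"
  shows "cmod (of_real x - w j) < sqrt (1 - x * (a - x)) * cmod (of_real a - w j)"
proof -
  have "x * (a - x) \<le> 1 * 1" using assms a by (intro mult_mono) auto
  then have "(sqrt (1 - x * (a - x)) * cmod (of_real a - w j))\<^sup>2
      = (1 - x * (a - x)) * (cmod (of_real a - w j))\<^sup>2"
    by (simp add: power_mult_distrib)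
  then show ?thesis
    using lune_dist_less[OF a less_imp_le[OF assms(1)] assms(2) w_disc[OF assms(3)] far[OF assms(3)]]
      \<open>x * (a - x) \<le> 1 * 1\<close>
    by (intro power2_less_imp_less[OF _ mult_nonneg_nonneg]) simp_all
qed

lemma F_real_coincidence:
  assumes x: "0 < x" "x < a"
  shows "\<exists>y. cmod y < sqrt (1 - x * (a - x)) \<and>
    cmod (F (of_real x)) = cmod (F' (of_real a)) / real n * (a - x) * cmod (\<Sum>k<n. y ^ k)"
proof -
  have "x * (a - x) < 1 * 1" by (rule mult_strict_mono) (use x a in auto)
  moreover have "0 \<le> x * (a - x)" using x by simp
  ultimately have T: "0 < sqrt (1 - x * (a - x))" "sqrt (1 - x * (a - x)) \<le> 1" by auto
  from F_coincidence[OF dist_critical_less[OF x] T]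
  obtain y where y: "cmod y < sqrt (1 - x * (a - x))"
    "F (of_real x) = F' (of_real a) * (of_real x - of_real a) * (\<Sum>k<n. y ^ k) / of_nat n"
    by blast
  have "cmod (of_real x - of_real a :: complex) = a - x"
    using x by (simp flip: of_real_diff)
  then show ?thesis using y(1) unfolding y(2)
    by (intro exI[of _ y]) (auto simp: norm_mult norm_divide)
qed

text \<open>The geometric sum is \<open>(1 - y ^ n) / (1 - y)\<close>, and \<open>1 - y\<close> has
  modulus at most 2.\<close>

lemma F_lower:
  assumes x: "0 < x" "x < a"
  shows "cmod (F' (of_real a)) / real n * (a - x) * ((1 - sqrt (1 - x * (a - x)) ^ n) / 2)
    \<le> cmod (F (of_real x))"
proof -
  let ?t = "sqrt (1 - x * (a - x))"
  obtain y where y: "cmod y < ?t"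
    "cmod (F (of_real x)) = cmod (F' (of_real a)) / real n * (a - x) * cmod (\<Sum>k<n. y ^ k)"
    using F_real_coincidence[OF x] by blast
  have "0 \<le> x * (a - x)" using x by simp
  then have "?t \<le> 1" by simp
  then have y1: "cmod (1 - y) \<le> 2" using norm_triangle_ineq4[of 1 y] y(1) unfolding norm_one by linarith
  have "1 - ?t ^ n \<le> 1 - cmod y ^ n" using y(1) by (simp add: power_mono)
  also have "\<dots> \<le> cmod (1 - y ^ n)" using norm_triangle_ineq2[of 1 "y ^ n"] by (simp add: norm_power)
  also have "\<dots> = cmod (1 - y) * cmod (\<Sum>k<n. y ^ k)"
    unfolding norm_mult[symmetric] one_diff_power_eq ..
  also have "\<dots> \<le> 2 * cmod (\<Sum>k<n. y ^ k)" using y1 by (intro mult_right_mono) auto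
  finally show ?thesis unfolding y(2) using x by (intro mult_left_mono) auto
qed

text \<open>The geometric series is at most \<open>1 / (1 - cmod y)\<close>, where
  \<open>1 - cmod y\<close> is at least \<open>x * (a - x) / 2\<close>; the factor
  \<open>a - x\<close> cancels.\<close>

lemma F_upper:
  assumes x: "0 < x" "x < a"
  shows "cmod (F (of_real x)) \<le> 2 * (cmod (F' (of_real a)) / real n) / x"
proof -
  let ?t = "sqrt (1 - x * (a - x))"
  obtain y where y: "cmod y < ?t"
    "cmod (F (of_real x)) = cmod (F' (of_real a)) / real n * (a - x) * cmod (\<Sum>k<n. y ^ k)"
    using F_real_coincidence[OF x] by blast
  have pos: "0 < x * (a - x)" using x by simp
  have "x * (a - x) \<le> 1 * 1" using x a by (intro mult_mono) auto
  then have t: "?t \<le> 1 - x * (a - x) / 2" by (intro sqrt_one_minus_le) simp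
  then have t1: "0 \<le> cmod y" "cmod y < 1" using y(1) pos by auto
  have "cmod (\<Sum>k<n. y ^ k) \<le> (\<Sum>k<n. cmod y ^ k)"
    by (rule order_trans[OF norm_sum]) (simp add: norm_power)
  also have "\<dots> = (1 - cmod y ^ n) / (1 - cmod y)"
    using one_diff_power_eq[of "cmod y" n] t1 by (simp add: field_simps)
  also have "\<dots> \<le> 1 / (x * (a - x) / 2)"
    using t1 t y(1) pos by (intro frac_le) auto
  finally have "cmod (F (of_real x)) \<le> cmod (F' (of_real a)) / real n * (a - x) * (1 / (x * (a - x) / 2))"
    unfolding y(2) using x by (intro mult_left_mono) auto
  also have "\<dots> = cmod (F' (of_real a)) / real n * ((a - x) * (1 / (x * (a - x) / 2)))"
    by (simp only: mult.assoc)
  also have "(a - x) * (1 / (x * (a - x) / 2)) = 2 / x"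
  proof -
    have "d * (1 / (x * d / 2)) = 2 / x" if "0 < d" for d using that by simp
    from this[of "a - x"] show ?thesis using x by linarith
  qed
  also have "cmod (F' (of_real a)) / real n * (2 / x) = 2 * (cmod (F' (of_real a)) / real n) / x"
    by simp
  finally show ?thesis .
qed

text \<open>In this disc the coincidence theorem applies with \<open>T = 1\<close>: half of
  \<open>c * (a - c)\<close> is what the square root leaves at \<open>c\<close>, and
  \<open>far\<close> scales the distance from \<open>c\<close> to match. A zero of the geometric sum
  is an \<open>n\<close>-th root of unity, so it has modulus 1 and cannot be
  \<open>y\<close>.\<close>

lemma F_nonzero_near:
  assumes c: "0 < c" "c < a" and z: "cmod (z - of_real c) < c * (a - c) / 2"
  shows "F z \<noteq> 0"
proof -
  have close: "cmod (z - w j) < 1 * cmod (of_real a - w j)" if "j < m" for j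
  proof -
    have "cmod (z - w j) \<le> cmod (z - of_real c) + cmod (of_real c - w j)"
      using norm_triangle_ineq[of "z - of_real c" "of_real c - w j"] by simp
    also have "cmod (z - of_real c) < c * (a - c) / 2 * 1" using z by simp
    also have "\<dots> \<le> c * (a - c) / 2 * cmod (of_real a - w j)"
      using far[OF that] c by (intro mult_left_mono) auto
    also have "cmod (of_real c - w j) \<le> (1 - c * (a - c) / 2) * cmod (of_real a - w j)"
    proof -
      have "c * (a - c) \<le> 1 * 1" using c a by (intro mult_mono) auto
      then have "sqrt (1 - c * (a - c)) \<le> 1 - c * (a - c) / 2" by (intro sqrt_one_minus_le) simp
      then have "sqrt (1 - c * (a - c)) * cmod (of_real a - w j)
          \<le> (1 - c * (a - c) / 2) * cmod (of_real a - w j)"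
        by (intro mult_right_mono) auto
      then show ?thesis using dist_critical_less[OF c that] by linarith
    qed
    finally show ?thesis by (simp add: algebra_simps)
  qed
  obtain y where y: "cmod y < 1"
    "F z = F' (of_real a) * (z - of_real a) * (\<Sum>k<n. y ^ k) / of_nat n"
    using F_coincidence[OF close] by auto
  have "z \<noteq> of_real a"
  proof
    assume "z = of_real a"
    then have "a - c < c * (a - c) / 2" using z c by (simp flip: of_real_diff)
    also have "\<dots> \<le> 1 * (a - c) / 2" using c a by (intro divide_right_mono mult_right_mono) auto
    finally show False using c by simp
  qed
  moreover have "(\<Sum>k<n. y ^ k) \<noteq> 0"
  proof
    assume "(\<Sum>k<n. y ^ k) = 0"
    then have "y ^ n = 1" using one_diff_power_eq[of y n] by simp
    then have "cmod y ^ n = 1" by (metis norm_one norm_power)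
    moreover have "cmod y ^ n < 1" using y(1) n_pos by (simp add: power_less_one_iff)
    ultimately show False by simp
  qed
  moreover have "F' (of_real a) \<noteq> 0" using F'_a_ge n_pos by auto
  ultimately show ?thesis using n_pos by (simp add: y(2))
qed

text \<open>Each squared distance is at most \<open>1 + x^2 - 2 * x * Re (Z k)\<close>, hence at
  most the exponential of \<open>x^2 - 2 * x * Re (Z k)\<close>; multiply and take
  logarithms.\<close>

lemma sum_Re_zeros_le:
  fixes x :: real
  assumes "0 < x" and L: "exp (- L) \<le> cmod (F (of_real x))"
  shows "2 * x * (\<Sum>k<n. Re (Z k)) \<le> real n * x\<^sup>2 + 2 * L"
proof -
  have "exp (- L) ^ 2 \<le> (cmod (F (of_real x)))\<^sup>2" using L by (intro power_mono) auto
  also have "\<dots> = (\<Prod>k<n. (cmod (of_real x - Z k))\<^sup>2)"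
    by (simp add: F_eq prod_power_distrib flip: prod_norm)
  also have "\<dots> \<le> (\<Prod>k<n. exp (x\<^sup>2 - 2 * x * Re (Z k)))"
  proof (intro prod_mono conjI)
    fix k assume "k \<in> {..<n}"
    then have "(cmod (Z k))\<^sup>2 \<le> 1" using Z by (simp add: power_le_one)
    moreover have "(cmod (of_real x - Z k))\<^sup>2 = x\<^sup>2 - 2 * x * Re (Z k) + (cmod (Z k))\<^sup>2"
      unfolding cmod_power2 by (simp add: power2_eq_square algebra_simps)
    ultimately show "(cmod (of_real x - Z k))\<^sup>2 \<le> exp (x\<^sup>2 - 2 * x * Re (Z k))"
      using exp_ge_add_one_self[of "x\<^sup>2 - 2 * x * Re (Z k)"] by linarith
  qed simp
  also have "\<dots> = exp (\<Sum>k<n. x\<^sup>2 - 2 * x * Re (Z k))" by (simp add: exp_sum)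
  also have "exp (- L) ^ 2 = exp (- 2 * L)" by (simp flip: exp_double)
  finally have "- 2 * L \<le> (\<Sum>k<n. x\<^sup>2 - 2 * x * Re (Z k))" by simp
  also have "\<dots> = real n * x\<^sup>2 - 2 * x * (\<Sum>k<n. Re (Z k))"
    by (simp add: sum_subtractf sum_distrib_left)
  finally show ?thesis by simp
qed

end

section \<open>Consequences of a large degree\<close>

text \<open>The assumption \<open>big\<close> is \<open>N0 a \<le> n\<close> cleared of its
  denominator.\<close>

locale sendov_large_counterexample = sendov_counterexample +
  assumes big: "32 * ln (40 / a\<^sup>2) \<le> real n * a\<^sup>2"
begin

definition D :: real where "D = cmod (F' (of_real a)) / real n"

lemma D_ge_1: "1 \<le> D" using F'_a_ge n_pos by (simp add: D_def)

text \<open>The condition on \<open>x\<close> covers \<open>a / 4\<close> and \<open>a / 2\<close>,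
  the two points of use. By \<open>big\<close> the power in \<open>F_lower\<close> drops to
  \<open>1 / 40\<close>, and \<open>39 / 80\<close> is \<open>(1 - 1 / 40) / 2\<close>.\<close>

lemma F_lower_middle:
  assumes x: "0 < x" "x < a" and q: "a\<^sup>2 / 16 \<le> x * (a - x)"
  shows "D * (a - x) * (39 / 80) \<le> cmod (F (of_real x))"
proof -
  let ?t = "sqrt (1 - x * (a - x))"
  have "x * (a - x) \<le> 1 * 1" using x a by (intro mult_mono) auto
  then have "?t \<le> 1 - x * (a - x) / 2" by (intro sqrt_one_minus_le) simp
  also have "\<dots> \<le> 1 + - (a\<^sup>2 / 32)" using q by simp
  also have "\<dots> \<le> exp (- (a\<^sup>2 / 32))" by (rule exp_ge_add_one_self)
  finally have "?t ^ n \<le> exp (- (a\<^sup>2 / 32)) ^ n"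
    using \<open>x * (a - x) \<le> 1 * 1\<close> by (intro power_mono) auto
  also have "\<dots> = exp (- (real n * a\<^sup>2 / 32))" by (simp flip: exp_of_nat_mult)
  also have "\<dots> \<le> exp (- ln (40 / a\<^sup>2))" using big by simp
  also have "\<dots> = a\<^sup>2 / 40" using a by (simp add: exp_minus)
  also have "\<dots> \<le> 1 / 40" using a by (simp add: power_le_one)
  finally have "39 / 80 \<le> (1 - ?t ^ n) / 2" by simp
  then have "D * (a - x) * (39 / 80) \<le> D * (a - x) * ((1 - ?t ^ n) / 2)"
    using x D_ge_1 by (intro mult_left_mono) auto
  then show ?thesis using F_lower[OF x] unfolding D_def by linarith
qed

lemma sum_Re_critical_le: "(\<Sum>j<m. Re (w j)) \<le> real m * (a / 4)"
proof -
  have "a\<^sup>2 \<le> a" using a by (simp add: power2_eq_square mult_le_cancel_left1)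
  then have "a\<^sup>2 / 40 \<le> 1 * ((a - a / 4) * (39 / 80))" using a by simp
  also have "\<dots> \<le> D * ((a - a / 4) * (39 / 80))"
    using D_ge_1 a by (intro mult_right_mono) auto
  also have "\<dots> \<le> cmod (F (of_real (a / 4)))"
    unfolding mult.assoc[symmetric]
    using a by (intro F_lower_middle) (auto simp: power2_eq_square)
  finally have "a\<^sup>2 / 40 \<le> cmod (F (of_real (a / 4)))" .
  moreover have "exp (- (real n * a\<^sup>2 / 32)) \<le> exp (- ln (40 / a\<^sup>2))" using big by simp
  moreover have "exp (- ln (40 / a\<^sup>2)) = a\<^sup>2 / 40" using a by (simp add: exp_minus)
  \<comment> \<open>Here \<open>L = n * a^2 / 32\<close>, so at \<open>x = a / 4\<close> both terms
    on the right equal \<open>n * a^2 / 16\<close>; this is where the mean \<open>a / 4\<close>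
    comes from.\<close>
  ultimately have "2 * (a / 4) * (\<Sum>k<n. Re (Z k)) \<le> real n * (a / 4)\<^sup>2 + 2 * (real n * a\<^sup>2 / 32)"
    using a by (intro sum_Re_zeros_le) auto
  then have "a / 2 * (\<Sum>k<n. Re (Z k)) \<le> a / 2 * (real n * (a / 4))"
    by (simp add: power2_eq_square mult_ac)
  then have le: "(\<Sum>k<n. Re (Z k)) \<le> real n * (a / 4)" using a by simp
  have "real n * (\<Sum>j<m. Re (w j)) = Re (of_nat n * (\<Sum>j<m. w j))" by simp
  also have "\<dots> = real m * (\<Sum>k<n. Re (Z k))" unfolding sum_critical by simp
  also have "\<dots> \<le> real m * (real n * (a / 4))" using le by (intro mult_left_mono) auto
  finally have "real n * (\<Sum>j<m. Re (w j)) \<le> real n * (real m * (a / 4))" by (simp add: mult_ac)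
  then show ?thesis using n_pos by simp
qed

text \<open>Moving from \<open>a\<close> to \<open>t\<close> lowers the squared distance
  \<open>d \<le> 4\<close> to \<open>w j\<close> by some \<open>e \<ge> 0\<close>, hence by a factor
  of at most \<open>exp (- e / 4)\<close>. The bound on the mean of \<open>Re (w j)\<close> makes
  the sum of the \<open>e / 4\<close> at least \<open>m * a^2 / 8\<close>.\<close>

lemma F'_small:
  assumes t: "0 \<le> t" "t \<le> a / 2"
  shows "cmod (F' (of_real t)) \<le> cmod (F' (of_real a)) * exp (- (real m * a\<^sup>2 / 16))"
proof (rule power2_le_imp_le)
  have each: "(cmod (of_real t - w j))\<^sup>2
      \<le> (cmod (of_real a - w j))\<^sup>2 * exp (- ((a - t) * (a + t - 2 * Re (w j)) / 4))"
    if "j < m" for j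
  proof -
    define d where "d = (cmod (of_real a - w j))\<^sup>2"
    define e where "e = (a - t) * (a + t - 2 * Re (w j))"
    have "Re (w j) < a / 2" using lune_Re_less[OF a(1) w_disc[OF that] far[OF that]] .
    then have e: "0 \<le> e" unfolding e_def using t by (intro mult_nonneg_nonneg) auto
    have "cmod (of_real a - w j) \<le> 2"
      using norm_triangle_ineq4[of "of_real a" "w j"] a w_disc[OF that] by simp
    then have "d \<le> 2\<^sup>2" unfolding d_def by (intro power_mono) auto
    then have "d * (e / 4) \<le> 4 * (e / 4)" using e by (intro mult_right_mono) auto
    moreover have "(cmod (of_real t - w j))\<^sup>2 = d - e"
      unfolding cmod_power2 d_def e_def by (simp add: power2_eq_square algebra_simps)
    ultimately have "(cmod (of_real t - w j))\<^sup>2 \<le> d * (1 + - (e / 4))" by (simp add: algebra_simps)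
    also have "\<dots> \<le> d * exp (- (e / 4))"
      by (intro mult_left_mono exp_ge_add_one_self) (auto simp: d_def)
    finally show ?thesis unfolding d_def e_def .
  qed
  have "(\<Sum>j<m. - ((a - t) * (a + t - 2 * Re (w j)) / 4))
      = - ((a - t) / 4 * (real m * (a + t) - 2 * (\<Sum>j<m. Re (w j))))"
    by (simp add: sum_negf sum_subtractf sum_distrib_left[symmetric] sum_divide_distrib[symmetric])
  also have "\<dots> \<le> - ((a - t) / 4 * (real m * (a + t) - 2 * (real m * (a / 4))))"
  proof -
    have "real m * (a + t) - 2 * (real m * (a / 4)) \<le> real m * (a + t) - 2 * (\<Sum>j<m. Re (w j))"
      using sum_Re_critical_le by linarith
    then show ?thesis using t by (intro le_imp_neg_le mult_left_mono) simp_all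
  qed
  also have "\<dots> = - (real m * (a\<^sup>2 / 8 + t * (a / 2 - t) / 4))"
    by (simp add: power2_eq_square field_simps)
  also have "\<dots> \<le> - (real m * (a\<^sup>2 / 8))"
    using t by (intro le_imp_neg_le mult_left_mono) auto
  finally have s: "(\<Sum>j<m. - ((a - t) * (a + t - 2 * Re (w j)) / 4)) \<le> - (real m * (a\<^sup>2 / 8))" .
  have "(cmod (F' (of_real t)))\<^sup>2 = (real n)\<^sup>2 * (\<Prod>j<m. (cmod (of_real t - w j))\<^sup>2)"
    by (simp add: F'_eq norm_mult power_mult_distrib prod_norm[symmetric] prod_power_distrib)
  also have "\<dots> \<le> (real n)\<^sup>2 * (\<Prod>j<m. (cmod (of_real a - w j))\<^sup>2
      * exp (- ((a - t) * (a + t - 2 * Re (w j)) / 4)))"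
    using each by (intro mult_left_mono prod_mono) auto
  also have "\<dots> = (cmod (F' (of_real a)))\<^sup>2 * exp (\<Sum>j<m. - ((a - t) * (a + t - 2 * Re (w j)) / 4))"
    by (simp add: F'_eq norm_mult power_mult_distrib prod_norm[symmetric] prod_power_distrib
        prod.distrib exp_sum)
  also have "\<dots> \<le> (cmod (F' (of_real a)))\<^sup>2 * exp (- (real m * (a\<^sup>2 / 8)))"
    using s by (intro mult_left_mono) auto
  also have "exp (- (real m * (a\<^sup>2 / 8))) = (exp (- (real m * a\<^sup>2 / 16)))\<^sup>2"
    by (simp flip: exp_double)
  finally show "(cmod (F' (of_real t)))\<^sup>2
      \<le> (cmod (F' (of_real a)) * exp (- (real m * a\<^sup>2 / 16)))\<^sup>2"
    by (simp add: power_mult_distrib)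
qed simp

text \<open>With \<open>v = n * a^2 / 32\<close> the exponential is \<open>exp (- v)\<close> twice,
  times \<open>exp (a^2 / 16)\<close> because \<open>m = n - 1\<close>. One copy absorbs
  \<open>n\<close>, the other is at most \<open>a^2 / 40\<close> and cancels the remaining
  \<open>1 / a^2\<close>.\<close>

lemma n_exp_small: "real n * exp (- (real m * a\<^sup>2 / 16)) \<le> 7 / 25"
proof -
  define v where "v = real n * a\<^sup>2 / 32"
  have a2: "0 < a\<^sup>2" "a\<^sup>2 \<le> 1" using a by (auto simp: power_le_one)
  have vE: "ln (40 / a\<^sup>2) \<le> v" using big by (simp add: v_def)
  have "exp 3 \<le> (40::real)"
  proof -
    have "exp 3 = (exp 1 ^ 3 :: real)" by (simp flip: exp_of_nat_mult)
    also have "\<dots> \<le> (3::real) ^ 3" by (intro power_mono exp_le) auto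
    finally show ?thesis by simp
  qed
  also have "40 \<le> 40 / a\<^sup>2" using a2 by (simp add: field_simps)
  finally have "3 \<le> ln (40 / a\<^sup>2)" using a2 by (subst ln_ge_iff) auto
  then have v3: "3 \<le> v" using vE by simp
  have "exp (- v) \<le> exp (- ln (40 / a\<^sup>2))" using vE by simp
  also have "\<dots> = a\<^sup>2 / 40" using a by (simp add: exp_minus)
  finally have ev: "exp (- v) \<le> a\<^sup>2 / 40" .
  have "exp (a\<^sup>2 / 16) \<le> exp (1 / 16)" using a2 by simp
  also have "\<dots> \<le> (9 / 8 :: real)" using exp_bound_lemma[of "1 / 16 :: real"] by simp
  finally have e: "exp (a\<^sup>2 / 16) \<le> 9 / 8" .
  have "real n * exp (- (real m * a\<^sup>2 / 16)) = 32 / a\<^sup>2 * (v * exp (- v)) * exp (- v) * exp (a\<^sup>2 / 16)"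
    using a2 by (simp add: v_def n field_simps flip: exp_add)
  also have "\<dots> \<le> 32 / a\<^sup>2 * (1 / 5) * (a\<^sup>2 / 40) * (9 / 8)"
    using mult_exp_minus_le[OF v3] ev e a2 v3 by (intro mult_mono) auto
  also have "\<dots> \<le> 7 / 25" using a2 by simp
  finally show ?thesis .
qed

text \<open>The derivative is so small on the segment from 0 to \<open>a / 2\<close> that the lower
  bound at \<open>a / 2\<close> survives at 0: \<open>39 / 160 - 7 / 50\<close> exceeds
  \<open>1 / 10\<close>.\<close>

lemma F_0_ge: "D * a / 10 \<le> cmod (F 0)"
proof -
  let ?S = "closed_segment 0 (complex_of_real (a / 2))"
  have "cmod (F (of_real (a / 2)) - F 0)
      \<le> cmod (F' (of_real a)) * exp (- (real m * a\<^sup>2 / 16)) * cmod (of_real (a / 2) - 0)"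
  proof (rule field_differentiable_bound[of ?S F F'])
    fix z assume "z \<in> ?S"
    then obtain u where u: "0 \<le> u" "u \<le> 1" "z = of_real (u * (a / 2))"
      by (auto simp: in_segment scaleR_conv_of_real)
    have "u * (a / 2) \<le> 1 * (a / 2)" using u a by (intro mult_right_mono) auto
    then show "cmod (F' z) \<le> cmod (F' (of_real a)) * exp (- (real m * a\<^sup>2 / 16))"
      unfolding u(3) using u a by (intro F'_small) auto
  qed (auto intro: DERIV_subset[OF poly_DERIV])
  also have "\<dots> = D * (a / 2) * (real n * exp (- (real m * a\<^sup>2 / 16)))"
    using a n_pos by (simp add: D_def)
  also have "\<dots> \<le> D * (a / 2) * (7 / 25)"
    using n_exp_small a D_ge_1 by (intro mult_left_mono) auto
  finally have d: "cmod (F (of_real (a / 2)) - F 0) \<le> D * a * (7 / 50)" by simp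
  have l: "D * (a - a / 2) * (39 / 80) \<le> cmod (F (of_real (a / 2)))"
    using a by (intro F_lower_middle) (auto simp: power2_eq_square)
  have "cmod (F (of_real (a / 2))) - cmod (F 0) \<le> cmod (F (of_real (a / 2)) - F 0)"
    by (rule norm_triangle_ineq2)
  then have "D * a * (39 / 160) - D * a * (7 / 50) \<le> cmod (F 0)" using d l by (simp add: algebra_simps)
  moreover have "0 \<le> D * a" using a D_ge_1 by simp
  ultimately show ?thesis by linarith
qed

lemma cmod_F_split: "cmod (F x) = cmod (x - of_real a) * (\<Prod>k=1..m. cmod (x - Z k))"
proof -
  have "{..<n} = insert 0 {1..m}" by (auto simp: n)
  then show ?thesis by (simp add: F_eq Z0 prod_norm[symmetric] norm_mult)
qed

lemma prod_zeros_ge: "1 / 10 \<le> (\<Prod>k=1..m. cmod (Z k))"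
proof -
  have "1 * (a / 10) \<le> D * (a / 10)" using D_ge_1 a by (intro mult_right_mono) auto
  then have "a * (1 / 10) \<le> a * (\<Prod>k=1..m. cmod (Z k))"
    using F_0_ge cmod_F_split[of 0] a by simp
  then show ?thesis using a by simp
qed

text \<open>The bound at 0 read the other way: the zeros lie in the unit disc, so
  \<open>cmod (F 0) \<le> a\<close>, which forces \<open>D \<le> 10\<close> in
  \<open>F_upper\<close>.\<close>

lemma F_le:
  assumes "0 < x" "x < a"
  shows "cmod (F (of_real x)) \<le> 20 / x"
proof -
  have "(\<Prod>k=1..m. cmod (Z k)) \<le> 1" using Z by (intro prod_le_1) (auto simp: n)
  then have "cmod (F 0) \<le> a" using cmod_F_split[of 0] a by (simp add: mult_le_cancel_left1)
  then have "a * (D / 10) \<le> a * 1" using F_0_ge by (simp add: mult.commute)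
  then have "D \<le> 10" using a by (simp add: mult_le_cancel_left)
  then have "2 * D / x \<le> 20 / x" using assms by (intro divide_right_mono) auto
  then show ?thesis using F_upper[OF assms] unfolding D_def by linarith
qed

end

section \<open>Blaschke factors and the lune\<close>

text \<open>The logarithm of the Blaschke factor at the real point \<open>exp t\<close>. Its
  derivative is \<open>(1 - c^2) / (1 + c^2 - c * (exp t + exp (- t)))\<close>, which decreases for
  \<open>t \<le> 0\<close> because \<open>exp t + exp (- t)\<close> does.\<close>

lemma concave_ln_blaschke:
  fixes c :: real
  assumes c: "0 < c" "c < 1"
  shows "concave_on {ln c<..0} (\<lambda>t. ln (exp t - c) - ln (1 - c * exp t))"
  unfolding concave_on_def
proof (rule convex_on_realI)
  let ?f = "\<lambda>t. - (exp t / (exp t - c) + c * exp t / (1 - c * exp t))"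
  have dom: "0 < exp t - c" "0 < 1 - c * exp t" if "t \<in> {ln c<..0}" for t
  proof -
    have "exp (ln c) < exp t" using that by (simp only: exp_less_cancel_iff) simp
    moreover have "exp t \<le> 1" using that by simp
    moreover have "c * exp t \<le> c * 1" using \<open>exp t \<le> 1\<close> c by (intro mult_left_mono) auto
    ultimately show "0 < exp t - c" "0 < 1 - c * exp t" using c by (simp, linarith)
  qed
  show "((\<lambda>t. - (ln (exp t - c) - ln (1 - c * exp t))) has_real_derivative ?f t) (at t)"
    if "t \<in> {ln c<..0}" for t
    using dom[OF that] by (auto intro!: derivative_eq_intros)
  show "?f s \<le> ?f t" if st: "s \<in> {ln c<..0}" "t \<in> {ln c<..0}" "s \<le> t" for s t
  proof -
    have f: "exp t / (exp t - c) + c * exp t / (1 - c * exp t)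
        = (1 - c\<^sup>2) / (1 + c\<^sup>2 - c * (exp t + 1 / exp t))"
      and pos: "0 < 1 + c\<^sup>2 - c * (exp t + 1 / exp t)" if "t \<in> {ln c<..0}" for t
    proof -
      have e: "1 + c\<^sup>2 - c * (exp t + 1 / exp t) = (exp t - c) * (1 - c * exp t) / exp t"
        by (simp add: field_simps power2_eq_square)
      show "0 < 1 + c\<^sup>2 - c * (exp t + 1 / exp t)" unfolding e using dom[OF that] by simp
      show "exp t / (exp t - c) + c * exp t / (1 - c * exp t)
        = (1 - c\<^sup>2) / (1 + c\<^sup>2 - c * (exp t + 1 / exp t))"
        unfolding e using dom[OF that] by (simp add: field_simps power2_eq_square)
    qed
    have "exp t + 1 / exp t \<le> exp s + 1 / exp s"
    proof -
      have "exp s \<le> exp t" "exp s \<le> 1" "exp t \<le> 1" using st by auto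
      then have "0 \<le> (exp t - exp s) * (1 - exp s * exp t)"
        by (intro mult_nonneg_nonneg) (auto simp: mult_le_one)
      then have "0 \<le> (exp t - exp s) * (1 - exp s * exp t) / (exp s * exp t)" by simp
      also have "\<dots> = (exp s + 1 / exp s) - (exp t + 1 / exp t)" by (simp add: field_simps)
      finally show ?thesis by simp
    qed
    then have "c * (exp t + 1 / exp t) \<le> c * (exp s + 1 / exp s)" using c by simp
    moreover have "0 \<le> 1 - c\<^sup>2" using c by (simp add: power_le_one)
    ultimately have "(1 - c\<^sup>2) / (1 + c\<^sup>2 - c * (exp t + 1 / exp t))
        \<le> (1 - c\<^sup>2) / (1 + c\<^sup>2 - c * (exp s + 1 / exp s))"
      using pos[OF st(1)] pos[OF st(2)] by (intro divide_left_mono mult_pos_pos) auto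
    then show ?thesis unfolding f[OF st(1)] f[OF st(2)] by simp
  qed
qed (simp add: is_interval_connected is_interval_oc)

text \<open>The real point \<open>\<rho>\<close> beyond \<open>c\<close> has pseudohyperbolic
  distance \<open>r\<close> from \<open>c\<close>. The exponent \<open>\<kappa>\<close> makes
  \<open>x powr \<kappa>\<close> agree with the Blaschke factor at \<open>x = \<rho>\<close> and at
  \<open>x = 1\<close>.\<close>

locale hyperbolic_radius =
  fixes c r \<rho> \<kappa> :: real
  assumes c: "0 < c" "c < 1" and r: "0 < r" "r \<le> 1 / 2" "r \<le> c"
    and \<rho>: "\<rho> = (c + r) / (1 + c * r)" and \<kappa>: "\<kappa> = ln r / ln \<rho>"
begin

lemma cr_pos: "0 < 1 + c * r" using c r by (simp add: add_pos_pos)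

lemma one_minus_rho: "1 - \<rho> = (1 - c) * (1 - r) / (1 + c * r)"
  using cr_pos by (simp add: \<rho> field_simps)

lemma rho_bounds: "c < \<rho>" "\<rho> < 1"
proof -
  have "0 < (1 - c) * (1 - r) / (1 + c * r)"
    using c r cr_pos by (intro divide_pos_pos mult_pos_pos) auto
  then show "\<rho> < 1" using one_minus_rho by linarith
  have "c * (c * r) < 1 * r" unfolding mult.assoc[symmetric]
    using c r mult_strict_mono[of c 1 c 1] by (intro mult_strict_right_mono) auto
  then show "c < \<rho>" using cr_pos by (simp add: \<rho> pos_less_divide_eq algebra_simps)
qed

lemma rho_pos: "0 < \<rho>" using rho_bounds c by simp

lemma ln_rho_neg: "ln \<rho> < 0" using rho_pos rho_bounds by simp

lemma kappa_rho: "\<kappa> * ln \<rho> = ln r" using ln_rho_neg by (simp add: \<kappa>)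

lemma rho_powr_kappa: "\<rho> powr \<kappa> = r"
  using rho_pos r by (simp add: powr_def kappa_rho)

lemma kappa_pos: "0 < \<kappa>"
  using ln_rho_neg r by (auto simp: \<kappa> intro!: divide_neg_neg)

text \<open>The bound \<open>(1 + c) / (1 - c)\<close> is the limit of \<open>\<kappa>\<close> as
  \<open>r\<close> tends to 1. The auxiliary function is nondecreasing up to its zero at 1; dividing
  by the negative \<open>ln \<rho>\<close> reverses the inequality.\<close>

lemma kappa_ge: "1 + c \<le> \<kappa> * (1 - c)"
proof -
  let ?h = "\<lambda>x. (1 - c) * ln x - (1 + c) * (ln (c + x) - ln (1 + c * x))"
  have "?h r \<le> ?h 1"
  proof (rule DERIV_nonneg_imp_nondecreasing[of r 1 ?h])
    fix x assume x: "r \<le> x" "x \<le> 1"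
    then have x0: "0 < x" "0 < c + x" "0 < 1 + c * x" using c r by (auto simp: add_pos_pos)
    let ?d = "(1 - c) * (1 / x) - (1 + c) * (1 / (c + x) - c / (1 + c * x))"
    have "(?h has_real_derivative ?d) (at x)"
      using x0 by (auto intro!: derivative_eq_intros)
    moreover have "?d = (1 - c) * c * (1 - x)\<^sup>2 / (x * (c + x) * (1 + c * x))"
      using x0 by (simp add: divide_simps) (simp add: power2_eq_square algebra_simps)
    moreover have "0 \<le> \<dots>" using x0 c by simp
    ultimately show "\<exists>y. (?h has_real_derivative y) (at x) \<and> 0 \<le> y" by (intro exI[of _ ?d] conjI) simp_all
  qed (use r in auto)
  also have "?h 1 = 0" by (simp add: add.commute)
  finally have "(1 - c) * ln r \<le> (1 + c) * (ln (c + r) - ln (1 + c * r))" by simp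
  also have "ln (c + r) - ln (1 + c * r) = ln \<rho>" using c r cr_pos by (simp add: \<rho> ln_div)
  finally have "(1 - c) * ln r \<le> (1 + c) * ln \<rho>" .
  then have "(1 - c) * \<kappa> * ln \<rho> \<le> (1 + c) * ln \<rho>" using kappa_rho by (simp add: mult.assoc)
  then show ?thesis using ln_rho_neg by (simp add: mult_le_cancel_right mult.commute)
qed

text \<open>In the variable \<open>ln x\<close> the logarithm of the left side is the chord, between
  \<open>ln \<rho>\<close> and 0, of a concave function.\<close>

lemma blaschke_radial_ge_powr:
  assumes x: "\<rho> \<le> x" "x \<le> 1"
  shows "x powr \<kappa> \<le> (x - c) / (1 - c * x)"
proof -
  define s where "s = ln x / ln \<rho>"
  have x0: "0 < x" "c < x" using x rho_pos rho_bounds by auto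
  have cx: "0 < 1 - c * x" 
  proof -
    have "c * x \<le> c * 1" using x c by (intro mult_left_mono) auto
    then show ?thesis using c by linarith
  qed
  have s: "0 \<le> s" "s \<le> 1"
    using x x0 ln_rho_neg rho_pos by (auto simp: s_def divide_nonpos_neg divide_le_eq)
  have lnx: "ln x = s * ln \<rho>" using ln_rho_neg by (simp add: s_def)
  let ?f = "\<lambda>t. ln (exp t - c) - ln (1 - c * exp t)"
  have "(1 - s) * ?f 0 + s * ?f (ln \<rho>) \<le> ?f ((1 - s) *\<^sub>R 0 + s *\<^sub>R ln \<rho>)"
    using s c rho_bounds rho_pos ln_rho_neg
    by (intro concave_onD[OF concave_ln_blaschke[OF c]]) (auto simp: ln_less_zero_iff)
  moreover have "?f 0 = 0" by simp
  moreover have "?f (ln \<rho>) = ln r"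
  proof -
    have q: "0 < 1 - c\<^sup>2" using c by (simp add: power_less_one_iff)
    have "\<rho> - c = r * ((1 - c\<^sup>2) / (1 + c * r))" "1 - c * \<rho> = (1 - c\<^sup>2) / (1 + c * r)"
      using cr_pos by (simp_all add: \<rho> field_simps power2_eq_square)
    then show ?thesis using rho_pos r cr_pos q by (simp add: ln_mult ln_div)
  qed
  ultimately have "\<kappa> * ln x \<le> ln (x - c) - ln (1 - c * x)"
    using x0 by (simp add: lnx[symmetric]) (simp add: lnx kappa_rho[symmetric] mult_ac)
  also have "\<dots> = ln ((x - c) / (1 - c * x))" using x0 cx by (simp add: ln_div)
  finally have "exp (\<kappa> * ln x) \<le> exp (ln ((x - c) / (1 - c * x)))" by (simp only: exp_le_cancel_iff)
  then show ?thesis using x0 cx by (simp add: powr_def)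
qed

lemma blaschke_identity:
  fixes z :: complex
  shows "(cmod (1 - of_real c * z))\<^sup>2 - (cmod (z - of_real c))\<^sup>2 = (1 - c\<^sup>2) * (1 - (cmod z)\<^sup>2)"
  unfolding cmod_power2 by (simp add: power2_eq_square algebra_simps)

text \<open>For \<open>cmod z \<ge> \<rho>\<close> the radial bound applies. Otherwise a quotient of
  at least \<open>r = \<rho> powr \<kappa>\<close> suffices. There remain points in the hyperbolic
  disc of radius \<open>r\<close> about \<open>c\<close> but outside the smaller Euclidean one;
  there \<open>cmod z\<close> is enough below \<open>\<rho>\<close>.\<close>

lemma blaschke_ge_powr:
  fixes z :: complex
  assumes z: "cmod z \<le> 1" and far: "r * (1 - c\<^sup>2) \<le> cmod (z - of_real c)"
  shows "cmod z powr \<kappa> \<le> cmod (z - of_real c) / cmod (1 - of_real c * z)"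
proof -
  let ?p = "cmod (z - of_real c)" and ?q = "cmod (1 - of_real c * z)"
  define \<delta> where "\<delta> = ?p / ?q"
  have c2: "0 < 1 - c\<^sup>2" using c by (simp add: power_less_one_iff)
  have "1 - c * cmod z \<le> ?q"
    using norm_triangle_ineq2[of 1 "of_real c * z"] c by (simp add: norm_mult)
  moreover have "c * cmod z \<le> c * 1" using z c by (intro mult_left_mono) auto
  ultimately have q: "0 < ?q" "1 - c * cmod z \<le> ?q" "0 < 1 - c * cmod z" using c by linarith+
  have p: "?p = \<delta> * ?q" using q by (simp add: \<delta>_def)
  have id: "?q\<^sup>2 * (1 - \<delta>\<^sup>2) = (1 - c\<^sup>2) * (1 - (cmod z)\<^sup>2)"
    using blaschke_identity[of z] unfolding p by (simp add: power_mult_distrib algebra_simps)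
  have \<delta>0: "0 \<le> \<delta>" by (simp add: \<delta>_def)
  show ?thesis
  proof (cases "\<rho> \<le> cmod z")
    case True
    \<comment> \<open>For a given modulus the quotient is least at the nonnegative real point:
      replace \<open>?q\<close> in the identity by its minimum.\<close>
    have "(1 - c * cmod z)\<^sup>2 \<le> ?q\<^sup>2" using q by (intro power_mono) auto
    moreover have "0 \<le> 1 - \<delta>\<^sup>2"
    proof -
      have "0 \<le> ?q\<^sup>2 * (1 - \<delta>\<^sup>2)" unfolding id using c2 z by (simp add: power_le_one)
      then show ?thesis using q by (simp add: zero_le_mult_iff)
    qed
    ultimately have "(1 - c * cmod z)\<^sup>2 * (1 - \<delta>\<^sup>2) \<le> (1 - c\<^sup>2) * (1 - (cmod z)\<^sup>2)"
      unfolding id[symmetric] by (rule mult_right_mono)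
    also have "\<dots> = (1 - c * cmod z)\<^sup>2 - (cmod z - c)\<^sup>2" by (simp add: power2_eq_square algebra_simps)
    finally have "(cmod z - c)\<^sup>2 \<le> \<delta>\<^sup>2 * (1 - c * cmod z)\<^sup>2" by (simp add: algebra_simps)
    then have "(cmod z - c)\<^sup>2 \<le> (\<delta> * (1 - c * cmod z))\<^sup>2" by (simp only: power_mult_distrib)
    then have "cmod z - c \<le> \<delta> * (1 - c * cmod z)"
      by (rule power2_le_imp_le) (use q \<delta>0 in auto)
    then have "(cmod z - c) / (1 - c * cmod z) \<le> \<delta>" using q by (simp add: divide_le_eq)
    then show ?thesis using blaschke_radial_ge_powr[OF True z] unfolding \<delta>_def by linarith
  next
    case False
    then have zr: "cmod z < \<rho>" by simp
    show ?thesis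
    proof (cases "r \<le> \<delta>")
      case True
      have "cmod z powr \<kappa> \<le> \<rho> powr \<kappa>" using zr kappa_pos by (intro powr_mono2) auto
      then show ?thesis using True rho_powr_kappa by (simp add: \<delta>_def)
    next
      case False
      \<comment> \<open>The relative excess of \<open>?q\<close> over \<open>1 - c^2\<close>, its
        value at \<open>z = c\<close>. The quotient is at least \<open>r / (1 + \<eta>)\<close>,
        while \<open>cmod z\<close> loses a factor \<open>exp (- b * \<eta>)\<close> against
        \<open>\<rho>\<close>.\<close>
      define \<eta> where "\<eta> = ?q / (1 - c\<^sup>2) - 1"
      have q\<eta>: "?q = (1 - c\<^sup>2) * (1 + \<eta>)" using c2 by (simp add: \<eta>_def)
      have "r * (1 - c\<^sup>2) \<le> \<delta> * ?q" using far p by simp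
      also have "\<dots> \<le> r * ?q" using False q by (intro mult_right_mono) auto
      finally have \<eta>0: "0 \<le> \<eta>" using r c2 by (simp add: \<eta>_def)
      have "r * (1 - c\<^sup>2) \<le> \<delta> * (1 + \<eta>) * (1 - c\<^sup>2)" using far p q\<eta> by (simp add: mult_ac)
      then have \<delta>_ge: "r / (1 + \<eta>) \<le> \<delta>" using c2 \<eta>0 by (simp add: divide_le_eq)
      define b where "b = (1 - c\<^sup>2) * (1 - r\<^sup>2)"
      have r2: "0 < 1 - r\<^sup>2" using r by (simp add: power_less_one_iff)
      have b: "0 < b" unfolding b_def using c2 r2 by simp
      have "(1 - c\<^sup>2) * (1 - (cmod z)\<^sup>2) = (1 - c\<^sup>2) * ((1 - c\<^sup>2) * (1 + \<eta>)\<^sup>2 * (1 - \<delta>\<^sup>2))"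
        unfolding id[symmetric] q\<eta> by (simp add: power2_eq_square)
      then have "1 - (cmod z)\<^sup>2 = (1 - c\<^sup>2) * (1 + \<eta>)\<^sup>2 * (1 - \<delta>\<^sup>2)" using c2 by simp
      also have "\<dots> \<ge> (1 - c\<^sup>2) * (1 + \<eta>)\<^sup>2 * (1 - r\<^sup>2)"
        using False \<delta>0 c2 by (intro mult_left_mono) (auto intro!: power_mono)
      finally have z2: "(cmod z)\<^sup>2 \<le> 1 - b * (1 + \<eta>)\<^sup>2" by (simp add: b_def mult_ac)
      have "1 - \<rho>\<^sup>2 = ((1 + c * r)\<^sup>2 - (c + r)\<^sup>2) / (1 + c * r)\<^sup>2"
        using cr_pos by (simp add: \<rho> power_divide diff_divide_distrib)
      also have "(1 + c * r)\<^sup>2 - (c + r)\<^sup>2 = b" by (simp add: b_def power2_eq_square algebra_simps)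
      also have "b / (1 + c * r)\<^sup>2 \<le> b / 1" using b c r cr_pos by (intro divide_left_mono) auto
      finally have \<rho>2: "1 - b \<le> \<rho>\<^sup>2" by simp
      have "b * (1 + \<eta>)\<^sup>2 \<ge> b * (1 + 2 * \<eta>)"
        using b by (intro mult_left_mono) (auto simp: power2_eq_square algebra_simps)
      then have "(cmod z)\<^sup>2 \<le> \<rho>\<^sup>2 - 2 * b * \<eta>" using z2 \<rho>2 by (simp add: algebra_simps)
      also have "\<dots> \<le> \<rho>\<^sup>2 - \<rho>\<^sup>2 * (2 * b * \<eta>)"
        using rho_bounds rho_pos b \<eta>0 by (simp add: power_le_one mult_left_le_one_le)
      also have "\<dots> = \<rho>\<^sup>2 * (1 + - (2 * b * \<eta>))" by (simp add: algebra_simps)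
      also have "\<dots> \<le> \<rho>\<^sup>2 * exp (- (2 * b * \<eta>))"
        by (intro mult_left_mono exp_ge_add_one_self) auto
      also have "\<dots> = (\<rho> * exp (- (b * \<eta>)))\<^sup>2"
        by (simp add: power_mult_distrib mult_ac flip: exp_double)
      finally have "cmod z \<le> \<rho> * exp (- (b * \<eta>))"
        by (rule power2_le_imp_le) (use rho_pos in auto)
      then have "cmod z powr \<kappa> \<le> (\<rho> * exp (- (b * \<eta>))) powr \<kappa>"
        using kappa_pos by (intro powr_mono2) auto
      also have "\<dots> = r * exp (- (\<kappa> * b * \<eta>))"
        using rho_pos rho_powr_kappa by (simp add: powr_mult powr_def[of "exp _"] mult_ac)
      also have "\<dots> \<le> r * exp (- \<eta>)"
      proof -
        \<comment> \<open>The aim is \<open>\<kappa> * b \<ge> 1\<close>. By \<open>kappa_ge\<close>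
          it suffices that \<open>(1 + c)^2 * (1 - r^2) \<ge> 1\<close>; since \<open>r\<close> is
          at most \<open>c\<close> and \<open>1 / 2\<close>, the negative terms cost at most
          \<open>c + c^2\<close>.\<close>
        have "r\<^sup>2 \<le> c * (1 / 2)" unfolding power2_eq_square using r c by (intro mult_mono) auto
        moreover have "c * r\<^sup>2 \<le> c * (1 / 2)\<^sup>2" using r c by (intro mult_left_mono power_mono) auto
        moreover have "c\<^sup>2 * r\<^sup>2 \<le> c\<^sup>2 * 1" using r by (intro mult_left_mono) (auto simp: power_le_one)
        moreover have "(1 + c)\<^sup>2 * (1 - r\<^sup>2) = 1 + 2 * c + c\<^sup>2 - r\<^sup>2 - 2 * (c * r\<^sup>2) - c\<^sup>2 * r\<^sup>2"
          by (simp add: power2_eq_square algebra_simps)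
        moreover have "c * (1 / 2)\<^sup>2 = c / 4" by (simp add: power2_eq_square)
        ultimately have "1 \<le> (1 + c)\<^sup>2 * (1 - r\<^sup>2)" using c by linarith
        also have "\<dots> = (1 + c) * ((1 + c) * (1 - r\<^sup>2))" by (simp add: power2_eq_square)
        also have "\<dots> \<le> \<kappa> * (1 - c) * ((1 + c) * (1 - r\<^sup>2))"
          using kappa_ge r2 c by (intro mult_right_mono) auto
        also have "\<dots> = \<kappa> * b" by (simp add: b_def power2_eq_square algebra_simps)
        finally have "1 * \<eta> \<le> \<kappa> * b * \<eta>" using \<eta>0 by (rule mult_right_mono)
        then show ?thesis using r by simp
      qed
      also have "\<dots> \<le> r * (1 / (1 + \<eta>))"
        using exp_ge_add_one_self[of \<eta>] \<eta>0 r
        by (intro mult_left_mono) (auto simp: exp_minus inverse_eq_divide intro!: divide_left_mono)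
      also have "\<dots> \<le> \<delta>" using \<delta>_ge by simp
      finally show ?thesis by (simp add: \<delta>_def)
    qed
  qed
qed

end

lemma ln_convex_combination_ge:
  fixes x y t :: real
  assumes "0 < x" "0 < y" "0 \<le> t" "t \<le> 1"
  shows "(1 - t) * ln x + t * ln y \<le> ln ((1 - t) * x + t * y)"
  using concave_onD[OF ln_concave, of t x y] assms by auto

text \<open>For given \<open>X = Re w\<close> the squared modulus is bounded below by its value on
  the circle around \<open>a\<close>, affine in \<open>X\<close>; left of \<open>a - 1\<close> the
  bound \<open>1 - c * X\<close> is used. At \<open>X = a / 2\<close>, \<open>a - 1\<close> and
  \<open>-1\<close> the bounds on the modulus are \<open>s\<close>, \<open>1 + c - a * c\<close> and
  \<open>1 + c\<close>. Concavity of \<open>ln\<close> and the two slope conditions put the line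
  below.\<close>

lemma ln_cmod_lune_ge:
  fixes a c A :: real and w :: complex
  defines "s \<equiv> sqrt (1 + c\<^sup>2 - a * c)"
  assumes a: "0 < a" "a < 1" and c: "0 < c" "c < a"
    and Ap: "A * (1 - a / 2) \<le> ln ((1 + c - a * c) / s)"
    and Aq: "A * (1 + a / 2) \<le> ln ((1 + c) / s)"
    and w: "cmod w \<le> 1" "1 \<le> cmod (of_real a - w)"
  shows "ln s + A * (a / 2 - Re w) \<le> ln (cmod (1 - of_real c * w))"
proof -
  define X where "X = Re w"
  define W where "W = (cmod w)\<^sup>2"
  have ac: "a * c < 1" using a c mult_strict_mono[of a 1 c 1] by simp
  have s2: "0 < 1 + c\<^sup>2 - a * c" using ac zero_le_power2[of c] by linarith
  then have s: "0 < s" by (simp add: s_def)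
  have k: "0 < 1 + c - a * c" using ac c by simp
  have W1: "W \<le> 1" using w by (simp add: W_def power_le_one)
  have "1 \<le> (cmod (of_real a - w))\<^sup>2" using w by (simp add: one_le_power)
  also have "\<dots> = a\<^sup>2 - 2 * a * X + W"
    unfolding X_def W_def cmod_power2 by (simp add: power2_eq_square algebra_simps)
  finally have W: "1 - a\<^sup>2 + 2 * a * X \<le> W" by simp
  then have "a * (2 * X) \<le> a * a" using W1 by (simp add: power2_eq_square)
  then have Xu: "X \<le> a / 2" using a by simp
  have "\<bar>X\<bar> \<le> 1" unfolding X_def using abs_Re_le_cmod[of w] w by linarith
  then have Xl: "- 1 \<le> X" by simp
  show ?thesis
  proof (cases "a - 1 \<le> X")
    case True
    \<comment> \<open>Position of \<open>X\<close> between \<open>a / 2\<close> at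
      \<open>t = 0\<close> and \<open>a - 1\<close> at \<open>t = 1\<close>.\<close>
    define t where "t = (a / 2 - X) / (1 - a / 2)"
    have t: "0 \<le> t" "t \<le> 1" using True Xu a by (auto simp: t_def divide_le_eq)
    have tX: "a / 2 - X = t * (1 - a / 2)" using a by (simp add: t_def)
    have X: "X = a / 2 - t * (1 - a / 2)" using tX by simp
    have "(1 - t) * s\<^sup>2 + t * (1 + c - a * c)\<^sup>2 = 1 - 2 * c * X + c\<^sup>2 * (1 - a\<^sup>2 + 2 * a * X)"
      using s2 by (simp add: s_def X) (simp add: power2_eq_square field_simps)
    also have "\<dots> \<le> 1 - 2 * c * X + c\<^sup>2 * W" using W by (simp add: mult_left_mono)
    also have "\<dots> = (cmod (1 - of_real c * w))\<^sup>2"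
      unfolding X_def W_def cmod_power2 by (simp add: power2_eq_square algebra_simps)
    finally have le: "(1 - t) * s\<^sup>2 + t * (1 + c - a * c)\<^sup>2 \<le> (cmod (1 - of_real c * w))\<^sup>2" .
    have pos: "0 < (1 - t) * s\<^sup>2 + t * (1 + c - a * c)\<^sup>2"
    proof (cases "t = 0")
      case False
      then show ?thesis using t s k by (intro add_nonneg_pos mult_pos_pos) auto
    qed (use s in simp)
    have "(1 - t) * ln (s\<^sup>2) + t * ln ((1 + c - a * c)\<^sup>2) \<le> ln ((1 - t) * s\<^sup>2 + t * (1 + c - a * c)\<^sup>2)"
      using s k t by (intro ln_convex_combination_ge) auto
    also have "\<dots> \<le> ln ((cmod (1 - of_real c * w))\<^sup>2)"
      using le pos less_le_trans[OF pos le] by (simp only: ln_le_cancel_iff)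
    finally have "(1 - t) * (2 * ln s) + t * (2 * ln (1 + c - a * c)) \<le> 2 * ln (cmod (1 - of_real c * w))"
      using s k le pos by (simp add: ln_realpow)
    then have "ln s + t * ln ((1 + c - a * c) / s) \<le> ln (cmod (1 - of_real c * w))"
      using s k by (simp add: ln_div algebra_simps)
    moreover have "t * (A * (1 - a / 2)) \<le> t * ln ((1 + c - a * c) / s)"
      using Ap t by (intro mult_left_mono) auto
    ultimately show ?thesis unfolding X_def[symmetric] tX by (simp add: mult_ac)
  next
    case False
    \<comment> \<open>Position of \<open>X\<close> between \<open>a - 1\<close> at
      \<open>t = 0\<close> and \<open>-1\<close> at \<open>t = 1\<close>.\<close>
    define t where "t = (a - 1 - X) / a"
    have t: "0 \<le> t" "t \<le> 1" using False Xl a by (auto simp: t_def divide_le_eq)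
    have X: "X = a - 1 - t * a" using a by (simp add: t_def)
    have "Re (1 - of_real c * w) \<le> cmod (1 - of_real c * w)" by (rule complex_Re_le_cmod)
    then have le: "(1 - t) * (1 + c - a * c) + t * (1 + c) \<le> cmod (1 - of_real c * w)"
      unfolding X_def[symmetric] by (simp add: X X_def[symmetric] algebra_simps)
    have pos: "0 < (1 - t) * (1 + c - a * c) + t * (1 + c)"
    proof (cases "t = 0")
      case False
      then show ?thesis using t c k by (intro add_nonneg_pos mult_pos_pos) auto
    qed (use k in simp)
    have end_points: "ln s + A * (1 - a / 2) \<le> ln (1 + c - a * c)" "ln s + A * (1 + a / 2) \<le> ln (1 + c)"
      using Ap Aq s k c by (simp_all add: ln_div)
    have "ln s + A * (a / 2 - X) = (1 - t) * (ln s + A * (1 - a / 2)) + t * (ln s + A * (1 + a / 2))"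
      by (simp add: X field_simps)
    also have "\<dots> \<le> (1 - t) * ln (1 + c - a * c) + t * ln (1 + c)"
      using t end_points by (intro add_mono mult_left_mono) auto
    also have "\<dots> \<le> ln ((1 - t) * (1 + c - a * c) + t * (1 + c))"
      using c k t by (intro ln_convex_combination_ge) auto
    also have "\<dots> \<le> ln (cmod (1 - of_real c * w))"
      using le pos less_le_trans[OF pos le] by (simp only: ln_le_cancel_iff)
    finally show ?thesis unfolding X_def .
  qed
qed

section \<open>Comparison at the point c\<close>

lemma ln_one_plus_ge:
  fixes u :: real
  assumes "- 1 < u"
  shows "u / (1 + u) \<le> ln (1 + u)"
proof -
  have "ln (1 / (1 + u)) \<le> 1 / (1 + u) - 1" using assms by (intro ln_le_minus_one) simp
  moreover have "1 / (1 + u) - 1 = - (u / (1 + u))" using assms by (simp add: field_simps)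
  moreover have "ln (1 / (1 + u)) = - ln (1 + u)" using assms by (simp add: ln_div)
  ultimately show ?thesis by simp
qed

lemma one_minus_le_cmod:
  fixes z :: complex
  assumes "0 \<le> c" "cmod z \<le> 1"
  shows "1 - c \<le> cmod (1 - of_real c * z)"
proof -
  have "c * cmod z \<le> c * 1" using assms by (intro mult_left_mono) auto
  moreover have "1 - c * cmod z \<le> cmod (1 - of_real c * z)"
    using norm_triangle_ineq2[of 1 "of_real c * z"] assms by (simp add: norm_mult)
  ultimately show ?thesis by linarith
qed

context sendov_large_counterexample
begin

text \<open>Each of the \<open>n\<close> terms of the logarithmic derivative is at most
  \<open>1 / (1 - c)\<close>, so \<open>n\<close> cancels; \<open>1 - a * c\<close> is the factor of
  the zero \<open>a\<close>.\<close>

lemma prod_reflected_critical_le: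
  assumes c: "0 < c" "c < 1"
  shows "(\<Prod>j<m. cmod (1 - of_real c * w j))
    \<le> (1 - a * c) / (1 - c) * (\<Prod>k=1..m. cmod (1 - of_real c * Z k))"
proof -
  let ?R = "\<Prod>k<n. cmod (1 - of_real c * Z k)"
  have each: "1 - c \<le> cmod (1 - of_real c * Z k)" if "k < n" for k
    using one_minus_le_cmod Z[OF that] c by simp
  have "cmod (\<Sum>k<n. 1 / (1 - of_real c * Z k)) \<le> (\<Sum>k<n. 1 / (1 - c))"
    using each c by (intro sum_norm_le) (auto simp: norm_divide intro!: divide_left_mono mult_pos_pos order_less_le_trans[OF _ each])
  then have "?R * cmod (\<Sum>k<n. 1 / (1 - of_real c * Z k)) \<le> ?R * (real n * (1 / (1 - c)))"
    by (intro mult_left_mono prod_nonneg) auto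
  moreover have "real n * (\<Prod>j<m. cmod (1 - of_real c * w j))
      = ?R * cmod (\<Sum>k<n. 1 / (1 - of_real c * Z k))"
    using arg_cong[OF prod_reflected_critical[OF c], of cmod]
    by (simp add: norm_mult flip: prod_norm)
  ultimately have "real n * (\<Prod>j<m. cmod (1 - of_real c * w j)) \<le> real n * (?R * (1 / (1 - c)))"
    by (simp add: mult_ac)
  then have "(\<Prod>j<m. cmod (1 - of_real c * w j)) \<le> ?R * (1 / (1 - c))"
    using n_pos by (simp only: mult_le_cancel_left_pos of_nat_0_less_iff)
  moreover have "?R = (1 - a * c) * (\<Prod>k=1..m. cmod (1 - of_real c * Z k))"
  proof -
    have "a * c < 1 * 1" using a c by (intro mult_strict_mono) auto
    moreover have "1 - complex_of_real c * of_real a = of_real (1 - a * c)" by (simp add: mult.commute)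
    ultimately have "cmod (1 - of_real c * of_real a) = 1 - a * c" by (simp only: norm_of_real)
    moreover have "{..<n} = insert 0 {1..m}" by (auto simp: n)
    ultimately show ?thesis by (simp add: Z0)
  qed
  ultimately show ?thesis by simp
qed

text \<open>By \<open>rc\<close> the Euclidean radius in \<open>blaschke_ge_powr\<close> is that of
  the zero-free disc. Multiplying over the zeros other than \<open>a\<close>, the powers give at
  least \<open>10 powr (- \<kappa>)\<close> and the numerators are controlled by
  \<open>F c\<close>.\<close>

lemma prod_reflected_zeros_le:
  assumes "hyperbolic_radius c r \<rho> \<kappa>" and ca: "c < a" and rc: "r * (1 - c\<^sup>2) = c * (a - c) / 2"
  shows "(\<Prod>k=1..m. cmod (1 - of_real c * Z k)) \<le> 20 / (c * (a - c)) * 10 powr \<kappa>"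
proof -
  interpret hyperbolic_radius c r \<rho> \<kappa> by fact
  let ?Q = "\<Prod>k=1..m. cmod (1 - of_real c * Z k)"
  have Q_pos: "0 < ?Q"
  proof (rule prod_pos)
    fix k assume "k \<in> {1..m}"
    then have "cmod (Z k) \<le> 1" using Z by (simp add: n)
    then show "0 < cmod (1 - of_real c * Z k)" using one_minus_le_cmod[of c "Z k"] c by linarith
  qed
  have each: "cmod (Z k) powr \<kappa> \<le> cmod (of_real c - Z k) / cmod (1 - of_real c * Z k)"
    if "k \<in> {1..m}" for k
  proof -
    have k: "k < n" using that by (simp add: n)
    have "F (Z k) = 0" using k by (auto simp: F_eq)
    then have "c * (a - c) / 2 \<le> cmod (Z k - of_real c)"
      using F_nonzero_near[OF c(1) ca, of "Z k"] by force
    then show ?thesis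
      using blaschke_ge_powr[OF Z[OF k]] rc by (simp add: norm_minus_commute)
  qed
  have "(1 / 10) powr \<kappa> \<le> (\<Prod>k=1..m. cmod (Z k)) powr \<kappa>"
    using prod_zeros_ge kappa_pos by (intro powr_mono2) auto
  also have "\<dots> = (\<Prod>k=1..m. cmod (Z k) powr \<kappa>)" by (rule prod_powr_distrib)
  also have "\<dots> \<le> (\<Prod>k=1..m. cmod (of_real c - Z k) / cmod (1 - of_real c * Z k))"
    using each by (intro prod_mono) auto
  also have "\<dots> = (\<Prod>k=1..m. cmod (of_real c - Z k)) / ?Q" by (rule prod_dividef)
  finally have "(1 / 10) powr \<kappa> * ?Q \<le> (\<Prod>k=1..m. cmod (of_real c - Z k))"
    using Q_pos by (simp add: pos_le_divide_eq)
  also have "\<dots> \<le> 20 / (c * (a - c))"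
  proof -
    have "cmod (of_real c - of_real a :: complex) = a - c" using ca by (simp flip: of_real_diff)
    then have "(a - c) * (\<Prod>k=1..m. cmod (of_real c - Z k)) \<le> 20 / c"
      using cmod_F_split[of "of_real c"] F_le[OF c(1) ca] by simp
    then show ?thesis using ca c by (simp add: pos_le_divide_eq mult_ac)
  qed
  finally have "?Q / 10 powr \<kappa> \<le> 20 / (c * (a - c))" by (simp add: powr_divide)
  then show ?thesis by (simp add: pos_divide_le_eq)
qed

text \<open>Sum the linear bound on the lune: since \<open>A \<ge> 0\<close>, the mean
  \<open>a / 4\<close> of the real parts is the worst case.\<close>

lemma ln_prod_reflected_critical_ge:
  fixes c A :: real
  defines "s \<equiv> sqrt (1 + c\<^sup>2 - a * c)"
  assumes c: "0 < c" "c < a" and A: "0 \<le> A"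
    and Ap: "A * (1 - a / 2) \<le> ln ((1 + c - a * c) / s)"
    and Aq: "A * (1 + a / 2) \<le> ln ((1 + c) / s)"
  shows "real m * (ln s + A * (a / 4)) \<le> ln (\<Prod>j<m. cmod (1 - of_real c * w j))"
proof -
  have "real m * (ln s + A * (a / 4)) = real m * ln s + A * (real m * (a / 2) - real m * (a / 4))"
    by (simp add: algebra_simps)
  also have "\<dots> \<le> real m * ln s + A * (real m * (a / 2) - (\<Sum>j<m. Re (w j)))"
    using sum_Re_critical_le A by (intro add_left_mono mult_left_mono diff_left_mono)
  also have "\<dots> = (\<Sum>j<m. ln s + A * (a / 2 - Re (w j)))"
    by (simp add: sum.distrib sum_subtractf flip: sum_distrib_left)
  also have "\<dots> \<le> (\<Sum>j<m. ln (cmod (1 - of_real c * w j)))"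
    using Ap Aq w_disc far unfolding s_def
    by (intro sum_mono ln_cmod_lune_ge[OF a c]) (auto simp: less_imp_le)
  also have "\<dots> = ln (\<Prod>j<m. cmod (1 - of_real c * w j))"
  proof (rule ln_prod[symmetric])
    fix j assume "j \<in> {..<m}"
    then have "cmod (w j) \<le> 1" using w_disc by simp
    then have "0 < cmod (1 - of_real c * w j)"
      using one_minus_le_cmod[of c "w j"] a c by linarith
    then show "cmod (1 - of_real c * w j) \<noteq> 0" by linarith
  qed simp
  finally show ?thesis .
qed

lemma degree_bound:
  assumes H: "hyperbolic_radius c r \<rho> \<kappa>" and ca: "c < a" and rc: "r * (1 - c\<^sup>2) = c * (a - c) / 2"
    and s: "s = sqrt (1 + c\<^sup>2 - a * c)" and A: "0 \<le> A"
    and Ap: "A * (1 - a / 2) \<le> ln ((1 + c - a * c) / s)"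
    and Aq: "A * (1 + a / 2) \<le> ln ((1 + c) / s)"
  shows "real m * (ln s + A * (a / 4))
    \<le> ln ((1 - a * c) / (1 - c)) + ln (20 / (c * (a - c))) + \<kappa> * ln 10"
proof -
  interpret hyperbolic_radius c r \<rho> \<kappa> by fact
  let ?p = "\<Prod>j<m. cmod (1 - of_real c * w j)"
  have "a * c < 1 * 1" using a c by (intro mult_strict_mono) auto
  then have pos: "0 < (1 - a * c) / (1 - c)" "0 < 20 / (c * (a - c))" using c ca by auto
  have "0 < ?p"
  proof (rule prod_pos)
    fix j assume "j \<in> {..<m}"
    then have "cmod (w j) \<le> 1" using w_disc by simp
    then show "0 < cmod (1 - of_real c * w j)"
      using one_minus_le_cmod[of c "w j"] a c by linarith
  qed
  have "?p \<le> (1 - a * c) / (1 - c) * (20 / (c * (a - c)) * 10 powr \<kappa>)"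
    using prod_reflected_critical_le[OF c] mult_left_mono[OF prod_reflected_zeros_le[OF H ca rc], of "(1 - a * c) / (1 - c)"] pos
    by linarith
  then have "ln ?p \<le> ln ((1 - a * c) / (1 - c) * (20 / (c * (a - c)) * 10 powr \<kappa>))"
    using \<open>0 < ?p\<close> pos by (subst ln_le_cancel_iff) auto
  also have "\<dots> = ln ((1 - a * c) / (1 - c)) + (ln (20 / (c * (a - c))) + \<kappa> * ln 10)"
    using pos by (subst ln_mult_pos, simp, simp, subst ln_mult_pos) (simp_all add: ln_powr)
  finally show ?thesis
    using ln_prod_reflected_critical_ge[OF c(1) ca A] Ap Aq unfolding s by linarith
qed

end

section \<open>Estimates for the explicit parameters\<close>

lemma cc_bounds:
  assumes a: "0 < a" "a < 1"
  shows "0 < cc a" "9 / 10 * a < cc a" "cc a < a" "a - cc a = a * (1 - a) / 10"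
proof -
  show d: "a - cc a = a * (1 - a) / 10"
    by (simp add: cc_def gam_def algebra_simps)
  have "0 < a * (1 - a)" "a * (1 - a) < a * 1" using a by (auto intro!: mult_strict_left_mono)
  then show "cc a < a" "9 / 10 * a < cc a" using d by (auto simp: algebra_simps)
  then show "0 < cc a" using a by linarith
qed

text \<open>From \<open>10 * (a - c) = a * (1 - a) \<le> 1 - a^2 \<le> 1 - c^2\<close> it follows
  that \<open>rr a \<le> c / 20\<close>; the last claim will absorb the constant 20 of
  \<open>F_le\<close>.\<close>

lemma hyperbolic_radius_cc:
  assumes a: "0 < a" "a < 1"
  shows "hyperbolic_radius (cc a) (rr a) ((cc a + rr a) / (1 + cc a * rr a))
      (ln (rr a) / ln ((cc a + rr a) / (1 + cc a * rr a)))"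
    and "rr a * (1 - (cc a)\<^sup>2) = cc a * (a - cc a) / 2"
    and "20 * rr a \<le> cc a * (1 + a)"
proof -
  define c where "c = cc a"
  have c: "0 < c" "c < a" "a - c = a * (1 - a) / 10" using cc_bounds[OF a] by (auto simp: c_def)
  have "c\<^sup>2 \<le> a\<^sup>2" using c by (intro power_mono) auto
  then have q: "1 - a\<^sup>2 \<le> 1 - c\<^sup>2" by simp
  have a2: "0 < 1 - a\<^sup>2" using a by (simp add: power_less_one_iff)
  have c2: "0 < 1 - c\<^sup>2" using q a2 by linarith
  have r: "rr a = c * (a - c) / (2 * (1 - c\<^sup>2))" by (simp add: rr_def c_def)
  have pos: "0 < rr a" unfolding r using c c2 by (intro divide_pos_pos mult_pos_pos) auto
  show rc: "rr a * (1 - (cc a)\<^sup>2) = cc a * (a - cc a) / 2"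
  proof -
    have "x / (2 * k) * k = x / 2" if "0 < k" for x k :: real using that by simp
    from this[OF c2] show ?thesis unfolding c_def[symmetric] r .
  qed
  have "a * (1 - a) \<le> 1 * (1 - a\<^sup>2)"
  proof -
    have "a * (1 - a) \<le> (1 + a) * (1 - a)" using a by (intro mult_right_mono) auto
    then show ?thesis by (simp add: power2_eq_square algebra_simps)
  qed
  then have "10 * (a - c) \<le> 1 - c\<^sup>2" using q c(3) by simp
  then have "c * (10 * (a - c)) \<le> c * (1 - c\<^sup>2)" using c by (intro mult_left_mono) auto
  moreover have "(20 * rr a) * (1 - c\<^sup>2) = 20 * (c * (a - c) / 2)"
    unfolding c_def mult.assoc rc by simp
  moreover have "20 * (c * (a - c) / 2) = c * (10 * (a - c))" by simp
  ultimately have "(20 * rr a) * (1 - c\<^sup>2) \<le> c * (1 - c\<^sup>2)" by (simp only:)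
  then have r20: "20 * rr a \<le> c" using c2 by (simp only: mult_le_cancel_right_pos)
  then show "hyperbolic_radius (cc a) (rr a) ((cc a + rr a) / (1 + cc a * rr a))
      (ln (rr a) / ln ((cc a + rr a) / (1 + cc a * rr a)))"
    using c a pos unfolding c_def[symmetric] by unfold_locales auto
  have "c * 1 \<le> c * (1 + a)" using c a by (intro mult_left_mono) auto
  then show "20 * rr a \<le> cc a * (1 + a)" using r20 unfolding c_def[symmetric] by linarith
qed

text \<open>The two terms of \<open>KK\<close> are the exponentials of chords of the lower bound for
  \<open>ln (cmod (1 - c * w))\<close> on the lune, evaluated at \<open>Re w = a / 4\<close>.\<close>

lemma KK_chords:
  fixes a :: real
  defines "c \<equiv> cc a" and "s \<equiv> sqrt (1 + (cc a)\<^sup>2 - a * cc a)"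
  assumes a: "0 < a" "a < 1"
  shows "ln (KK a) \<le> ln s + ln ((1 + c - a * c) / s) / (1 - a / 2) * (a / 4)"
    and "ln (KK a) \<le> ln s + ln ((1 + c) / s) / (1 + a / 2) * (a / 4)"
    and "1 < KK a" and "0 < ln ((1 + c - a * c) / s)" and "0 < ln ((1 + c) / s)"
proof -
  have c: "0 < c" "c < a" "a - c = a * (1 - a) / 10" using cc_bounds[OF a] by (auto simp: c_def)
  define y where "y = c * (1 - a)"
  have y: "0 < y" "1 + c - a * c = 1 + y" using c a by (auto simp: y_def algebra_simps)
  have "y \<le> a * (1 - a)" unfolding y_def using c a by (intro mult_right_mono) auto
  also have "\<dots> \<le> 1 / 4" using zero_le_power2[of "a - 1 / 2"] by (simp add: power2_eq_square algebra_simps)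
  finally have y4: "y \<le> 1 / 4" .
  \<comment> \<open>This is \<open>c * (a - c)\<close>, so that \<open>s^2 = 1 - x\<close>.\<close>
  define x where "x = a * y / 10"
  have x0: "0 < x" using a y by (simp add: x_def)
  have "a * y \<le> 1 * (1 / 4)" using a y y4 by (intro mult_mono) auto
  then have x40: "x \<le> 1 / 40" by (simp add: x_def)
  have "c * (a - c) = x" unfolding x_def y_def c(3) by simp
  then have s: "s = sqrt (1 - x)" by (simp add: s_def c_def[symmetric] power2_eq_square algebra_simps)
  have s0: "0 < s" using x40 by (simp add: s)
  have s1: "s < 1" using x0 by (simp add: s)
  have lns: "ln s = ln (1 - x) / 2" using x40 by (simp add: s ln_sqrt)
  have "- (x * (11 / 10)) \<le> - (x / (1 - x))"
  proof -
    have "x * (1 / (1 - x)) \<le> x * (11 / 10)"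
      using x0 x40 by (intro mult_left_mono) (auto simp: divide_le_eq)
    then show ?thesis by simp
  qed
  also have "\<dots> \<le> ln (1 - x)" using ln_one_plus_ge[of "- x"] x40 by simp
  finally have lnx: "- (x * (11 / 20)) \<le> ln s" using lns by simp
  have lns_neg: "ln s < 0" using s0 s1 by simp
  have p: "0 < pp a" "a / 4 \<le> pp a" and q: "0 < qq a" "a / 6 \<le> qq a"
    using a by (auto simp: pp_def qq_def field_simps)
  have lny: "4 / 5 * y \<le> ln (1 + y)"
  proof -
    have "y * (4 / 5) \<le> y * (1 / (1 + y))"
      using y y4 by (intro mult_left_mono) (auto simp: le_divide_eq)
    also have "\<dots> = y / (1 + y)" by simp
    also have "\<dots> \<le> ln (1 + y)" using ln_one_plus_ge[of y] y by simp
    finally show ?thesis by simp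
  qed
  have lnc: "c / 2 \<le> ln (1 + c)"
  proof -
    have "c / 2 \<le> c / (1 + c)" using c a by (intro divide_left_mono) auto
    also have "\<dots> \<le> ln (1 + c)" using ln_one_plus_ge[of c] c by simp
    finally show ?thesis .
  qed
  let ?K1 = "(1 + c - a * c) powr (pp a) * s powr (1 - pp a)"
  let ?K2 = "(1 + c) powr (qq a) * s powr (1 - qq a)"
  have K: "KK a = min ?K1 ?K2" by (simp add: KK_def Let_def s_def c_def)
  have pos: "0 < ?K1" "0 < ?K2" using s0 y c by auto
  have div: "ln ((1 + c - a * c) / s) = ln (1 + y) - ln s" "ln ((1 + c) / s) = ln (1 + c) - ln s"
    using s0 y c by (simp_all add: ln_div)
  have K1: "ln ?K1 = ln s + pp a * (ln (1 + y) - ln s)"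
    using s0 y by (simp add: ln_mult_pos ln_powr algebra_simps)
  have K2: "ln ?K2 = ln s + qq a * (ln (1 + c) - ln s)"
    using s0 c by (simp add: ln_mult_pos ln_powr algebra_simps)
  show "ln (KK a) \<le> ln s + ln ((1 + c - a * c) / s) / (1 - a / 2) * (a / 4)"
  proof -
    have "ln (KK a) \<le> ln ?K1" unfolding K using pos by (subst ln_le_cancel_iff) auto
    then show ?thesis unfolding K1 div by (simp add: pp_def mult_ac)
  qed
  show "ln (KK a) \<le> ln s + ln ((1 + c) / s) / (1 + a / 2) * (a / 4)"
  proof -
    have "ln (KK a) \<le> ln ?K2" unfolding K using pos by (subst ln_le_cancel_iff) auto
    then show ?thesis unfolding K2 div by (simp add: qq_def mult_ac)
  qed
  show "0 < ln ((1 + c - a * c) / s)" unfolding div using lny y lns_neg by linarith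
  show "0 < ln ((1 + c) / s)" unfolding div using lnc c lns_neg by linarith
  \<comment> \<open>The loss from \<open>ln s\<close> is at most \<open>11 / 200 * a * y\<close>;
    the gains are at least \<open>a * y / 5\<close> here and \<open>a * c / 12\<close> for
    \<open>?K2\<close>, where \<open>y < c\<close>.\<close>
  have "0 < ln ?K1"
  proof -
    have "a / 4 * (4 / 5 * y) \<le> pp a * (ln (1 + y) - ln s)"
      using p a y lny lns_neg by (intro mult_mono) auto
    moreover have "x * (11 / 20) < a / 4 * (4 / 5 * y)" using a y by (simp add: x_def)
    ultimately show ?thesis unfolding K1 using lnx by linarith
  qed
  moreover have "0 < ln ?K2"
  proof -
    have "a / 6 * (c / 2) \<le> qq a * (ln (1 + c) - ln s)"
      using q a c lnc lns_neg by (intro mult_mono) auto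
    moreover have "x * (11 / 20) < a / 6 * (c / 2)"
    proof -
      have "y < c" using c a by (simp add: y_def)
      then have "a * y < a * c" using a by simp
      moreover have "0 < a * c" using a c by simp
      ultimately show ?thesis by (simp add: x_def)
    qed
    ultimately show ?thesis unfolding K2 using lnx by linarith
  qed
  ultimately show "1 < KK a" unfolding K using pos by (simp add: ln_gt_zero_iff)
qed

context sendov_large_counterexample
begin

lemma degree_le_N3: "real n \<le> N3 a"
proof -
  define c where "c = cc a"
  define r where "r = rr a"
  define \<rho> where "\<rho> = (c + r) / (1 + c * r)"
  define \<kappa> where "\<kappa> = ln r / ln \<rho>"
  define s where "s = sqrt (1 + c\<^sup>2 - a * c)"
  have H: "hyperbolic_radius c r \<rho> \<kappa>" and rc: "r * (1 - c\<^sup>2) = c * (a - c) / 2"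
    and r20: "20 * r \<le> c * (1 + a)"
    using hyperbolic_radius_cc[OF a] by (auto simp: c_def r_def \<rho>_def \<kappa>_def)
  interpret hyperbolic_radius c r \<rho> \<kappa> by (rule H)
  have ca: "c < a" "9 / 10 * a < c" using cc_bounds[OF a] by (auto simp: c_def)
  note K = KK_chords[OF a, folded c_def, folded s_def]
  let ?Ap = "ln ((1 + c - a * c) / s) / (1 - a / 2)" and ?Aq = "ln ((1 + c) / s) / (1 + a / 2)"
  \<comment> \<open>The smaller chord slope meets both slope conditions, and its line at
    \<open>Re w = a / 4\<close> still dominates \<open>ln (KK a)\<close>.\<close>
  define A where "A = min ?Ap ?Aq"
  have A0: "0 \<le> A" using K(4,5) a by (auto simp: A_def)
  have Ap: "A * (1 - a / 2) \<le> ln ((1 + c - a * c) / s)"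
    using a by (simp add: A_def flip: pos_le_divide_eq)
  have Aq: "A * (1 + a / 2) \<le> ln ((1 + c) / s)"
    using a by (simp add: A_def flip: pos_le_divide_eq)
  have "ln (KK a) \<le> ln s + A * (a / 4)" using K(1,2) unfolding A_def min_def by presburger
  then have "real m * ln (KK a) \<le> real m * (ln s + A * (a / 4))" by (intro mult_left_mono) auto
  also have "\<dots> \<le> ln ((1 - a * c) / (1 - c)) + ln (20 / (c * (a - c))) + \<kappa> * ln 10"
    by (rule degree_bound[OF H ca(1) rc s_def A0 Ap Aq])
  \<comment> \<open>Since \<open>\<rho> > c > 9 / 10 * a\<close>, the number 10 is below
    \<open>16 * \<rho> / a\<close>. The \<open>16 / a\<close> produces \<open>alpha a\<close>, and
    \<open>\<kappa> * ln \<rho>\<close> leaves a spare \<open>ln r\<close>.\<close>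
  also have "\<kappa> * ln 10 \<le> - alpha a * ln r + ln r"
  proof -
    have "10 \<le> 16 * \<rho> / a" using ca rho_bounds a by (simp add: le_divide_eq)
    then have "ln 10 \<le> ln (16 * \<rho> / a)" by (subst ln_le_cancel_iff) auto
    also have "\<dots> = - ln (a / 16) + ln \<rho>"
      using a rho_pos by (simp add: ln_div ln_mult_pos)
    finally have "\<kappa> * ln 10 \<le> \<kappa> * (- ln (a / 16) + ln \<rho>)" using kappa_pos by simp
    also have "\<dots> = - alpha a * ln r + ln r"
      using kappa_rho by (simp add: alpha_def \<kappa>_def \<rho>_def c_def r_def algebra_simps)
    finally show ?thesis .
  qed
  finally have "real m * ln (KK a) \<le> ln ((1 - a * c) / (1 - c))
      + (ln (20 / (c * (a - c))) + ln r) - alpha a * ln r" by simp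
  \<comment> \<open>The spare \<open>ln r\<close> pays for the 20 and for the
    \<open>1 / c\<close>.\<close>
  also have "ln (20 / (c * (a - c))) + ln r \<le> ln ((1 + a) / (a - c))"
  proof -
    have "ln (20 / (c * (a - c))) + ln r = ln (20 / (c * (a - c)) * r)"
      using c ca r by (subst ln_mult_pos) auto
    also have "20 / (c * (a - c)) * r = 20 * r / c / (a - c)" by simp
    also have "ln (20 * r / c / (a - c)) \<le> ln ((1 + a) / (a - c))"
    proof (subst ln_le_cancel_iff)
      show "20 * r / c / (a - c) \<le> (1 + a) / (a - c)"
        using r20 c ca by (intro divide_right_mono) (auto simp: divide_le_eq mult_ac)
    qed (use c ca r a in auto)
    finally show ?thesis .
  qed
  finally have "real m * ln (KK a) \<le> ln ((1 + a) / (a - c)) + ln ((1 - a * c) / (1 - c)) - alpha a * ln r"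
    by simp
  moreover have "0 < ln (KK a)" using K(3) by simp
  ultimately have "real m \<le> (ln ((1 + a) / (a - c)) + ln ((1 - a * c) / (1 - c)) - alpha a * ln r) / ln (KK a)"
    by (simp add: pos_le_divide_eq)
  then show ?thesis by (simp add: N3_def Let_def c_def r_def n)
qed

end

section \<open>From the negated conclusion to a counterexample of bounded degree\<close>

theorem mainTheorem12:
  fixes a :: real and n :: nat and z :: "nat \<Rightarrow> complex" and P :: "complex poly"
  assumes "0 < a" "a < 1" "n \<ge> 2"
    and "\<And>j. j \<in> {1..n-1} \<Longrightarrow> cmod (z j) \<le> 1"
    and "P = [:- complex_of_real a, 1:] * (\<Prod>j=1..n-1. [:- z j, 1:])"
    and "real n > max (N1 a) (max (N2 a (cc a)) (N3 a))"
  shows "\<exists>w. cmod (w - complex_of_real a) \<le> 1 \<and> poly (pderiv P) w = 0"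
proof (rule ccontr)
  assume no: "\<not> ?thesis"
  define m where "m = n - 1"
  have n: "n = Suc m" "0 < m" using assms(3) by (auto simp: m_def)
  define Z where "Z k = (if k = 0 then complex_of_real a else z k)" for k
  have "{..<n} = insert 0 {1..n - 1}" using n by auto
  then have "(\<Prod>k<n. [:- Z k, 1:]) = [:- Z 0, 1:] * (\<Prod>k=1..n - 1. [:- Z k, 1:])" by simp
  also have "(\<Prod>k=1..n - 1. [:- Z k, 1:]) = (\<Prod>j=1..n-1. [:- z j, 1:])"
    by (intro prod.cong) (auto simp: Z_def)
  finally have P: "P = (\<Prod>k<n. [:- Z k, 1:])" by (simp add: assms(5) Z_def)
  have degP: "degree P = n" and leadP: "coeff P n = 1"
    unfolding P by (rule monic_linear_factors)+
  have deg: "degree (pderiv P) = m" using degP n by (simp add: degree_pderiv)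
  have lead: "lead_coeff (pderiv P) = of_nat n"
    using leadP n unfolding deg by (simp add: coeff_pderiv)
  then have "pderiv P \<noteq> 0" using assms(3) by auto
  then obtain w where w: "pderiv P = smult (lead_coeff (pderiv P)) (\<Prod>j<degree (pderiv P). [:- w j, 1:])"
    by (rule complex_poly_linear_factors)
  have P': "pderiv P = smult (of_nat n) (\<Prod>j<m. [:- w j, 1:])"
    by (rule w[unfolded lead, unfolded deg])
  have "sendov_large_counterexample a n m Z w P"
  proof
    show "1 < cmod (of_real a - w j)" if "j < m" for j
    proof -
      have "poly (pderiv P) (w j) = 0" using that by (auto simp: P' poly_prod)
      then show ?thesis using no by (force simp: norm_minus_commute)
    qed
    \<comment> \<open>\<open>N0 a\<close> enters as one argument of the maximum
      \<open>N1 a\<close>.\<close>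
    have "N0 a \<le> real n" using assms(6) by (simp add: N1_def)
    then show "32 * ln (40 / a\<^sup>2) \<le> real n * a\<^sup>2"
      using assms(1) by (simp add: N0_def pos_divide_le_eq)
    show "cmod (Z k) \<le> 1" if "k < n" for k
      using that assms(1,2) assms(4)[of k] by (auto simp: Z_def)
  qed (use assms(1,2) n P P' in \<open>auto simp: Z_def\<close>)
  then have "real n \<le> N3 a" by (rule sendov_large_counterexample.degree_le_N3)
  then show False using assms(6) by simp
qed

end
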